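(* Let $1\le p_i\le+\infty$ and $\omega_i>0$ for $i=1,\dots,m$, let $x_1,\dots,x_n\in\mathbb{R}^d$ be demand points with weights $w_1,\dots,w_n>0$, $x_l\in P_{s_l}$, and $N=\{1,\dots,n\}$. The location problem (LocP) is equivalent to the following mixed-integer problem (LocP-F2): $$\min\sum_{l\in N}\sum_{i\in V}w_l\omega_i d_i^l$$ subject to 1. $\sum_{i\in V}u_i=1$; 2. $\sum_{e\in \mathrm{Ext}(P_i)}\mu_{ie}=u_i$ for all $i\in V$; 3. $\sum_{(s_l,j)\in A}z^l_{s_lj}-\sum_{(h,s_l)\in A}z^l_{hs_l}=1-u_{s_l}$ for all $l\in N$; 4. $\sum_{(i,j)\in A}z^l_{ij}-\sum_{(h,i)\in A}z^l_{hi}=-u_i$ for all $l\in N$, $i\in V\setminus\{s_l\}$; 5. $\sum_{(h,i)\in A}z^l_{hi}\le1-u_{s_l}$ for all $l\in N$, $i\in V$; 6. $\sum_{(i,j)\in A}z^l_{ij}\le1-u_{s_l}$ for all $l\in N$, $i\in V$; 7. $d^l_{s_l}\ge\sum_{(s_l,j)\in A}\big\|\sum_{e\in \mathrm{Ext}(F_{s_lj})}\lambda^l_{s_lje}e-x_lz^l_{s_lj}\big\|_{p_{s_l}}+\big\|\sum_{e\in \mathrm{Ext}(P_{s_l})}\mu_{s_le}e-x_lu_{s_l}\big\|_{p_{s_l}}$ for all $l\in N$; 8. $d^l_i\ge\sum_{(h,i)\in A}\sum_{(i,j)\in A}\big\|\sum_{e\in \mathrm{Ext}(F_{ij})}\Psi^l_{hije}e-\sum_{e\in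 \mathrm{Ext}(F_{hi})}\Phi^l_{hije}e\big\|_{p_i}+\sum_{(h,i)\in A}\big\|\sum_{e\in \mathrm{Ext}(P_i)}\Theta^l_{hie}e-\sum_{e\in \mathrm{Ext}(F_{hi})}\Upsilon^l_{hie}e\big\|_{p_i}$ for all $l\in N$, $i\in V\setminus\{s_l\}$; 9. $\sum_{e\in \mathrm{Ext}(F_{ij})}\lambda^l_{ije}=z^l_{ij}$ for all $l\in N$, $(i,j)\in A$; and, for all $l\in N$ and $i\in V\setminus\{s_l\}$: 10. $\sum_{(i,j)\in A}\rho^l_{hij}+\sum_{e\in \mathrm{Ext}(P_i)}\Theta^l_{hie}=z^l_{hi}$ for all $(h,i)\in A$; 11. $\sum_{(h,i)\in A}\rho^l_{hij}=z^l_{ij}$ for all $(i,j)\in A$; 12. $\sum_{e\in \mathrm{Ext}(F_{hi})}\Phi^l_{hije}=\rho^l_{hij}$ for all $(h,i),(i,j)\in A$; 13. $\sum_{(i,j)\in A}\Phi^l_{hije}+\Upsilon^l_{hie}=\lambda^l_{hie}$ for all $(h,i)\in A$, $e\in \mathrm{Ext}(F_{hi})$; 14. $\sum_{e\in \mathrm{Ext}(F_{ij})}\Psi^l_{hije}=\rho^l_{hij}$ for all $(h,i),(i,j)\in A$; 15. $\sum_{(h,i)\in A}\Psi^l_{hije}=\lambda^l_{ije}$ for all $(i,j)\in A$, $e\in \mathrm{Ext}(F_{ij})$; 16. $\sum_{(h,i)\in A}\sum_{e\in \mathrm{Ext}(F_{hi})}\Upsilon^l_{hie}=u_i$; 17.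 $\sum_{(h,i)\in A}\sum_{e\in \mathrm{Ext}(P_i)}\Theta^l_{hie}=u_i$; 18. $\sum_{(h,i)\in A}\Theta^l_{hie}=\mu_{ie}$ for all $e\in \mathrm{Ext}(P_i)$; with variable domains 19. $u_i\in\{0,1\}$ for $i\in V$; $\mu_{ie}\ge0$ for $i\in V,e\in \mathrm{Ext}(P_i)$; $d_i^l\ge0$ for $l\in N,i\in V$; $z^l_{ij}\in\{0,1\}$ for $l\in N,(i,j)\in A$; $\lambda^l_{ije}\ge0$ for $l\in N,(i,j)\in A,e\in \mathrm{Ext}(F_{ij})$; and for all $l\in N$, $i\in V\setminus\{s_l\}$, $(h,i),(i,j)\in A$: $\rho^l_{hij}\ge0$, $\Phi^l_{hije}\ge0$ $(e\in \mathrm{Ext}(F_{hi}))$, $\Psi^l_{hije}\ge0$ $(e\in \mathrm{Ext}(F_{ij}))$, and for all $l\in N$, $i\in V\setminus\{s_l\}$, $(h,i)\in A$: $\Upsilon^l_{hie}\ge0$ $(e\in \mathrm{Ext}(F_{hi}))$, $\Theta^l_{hie}\ge0$ $(e\in \mathrm{Ext}(P_i))$. Here "equivalent" means: the two problems have the same optimal value; every optimal solution of (LocP) (a cell $P_t$, a location $x\in P_t$, and optimal paths and gate points from each $x_l$ to $x$) is encoded by an optimal solution of (LocP-F2) with $u_t=1$, $x=\sum_{e\in \mathrm{Ext}(P_t)}\mu_{te}e$, and $z^l,\lambda^l$ encoding the arcs and gate points of the path of demand point $l$; and conversely, for every optimal solution of (LocP-F2), the cell $P_t$ with $u_t=1$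 and the point $x=\sum_{e\in \mathrm{Ext}(P_t)}\mu_{te}e$ are optimal for (LocP).
   Context: Setting. $P_1,\dots,P_m\subseteq\mathbb{R}^d$ are the cells of a polyhedral subdivision, with $\mathrm{int}(P_i)\cap\mathrm{int}(P_j)=\emptyset$ for $i\ne j$; the cells are assumed to be polytopes (bounded polyhedra). Cell $P_i$ is endowed with the $\ell_{p_i}$-norm $\|\cdot\|_{p_i}$ and a weight $\omega_i>0$. The undirected graph $G=(V,E)$ has $V=\{1,\dots,m\}$ and $\{i,j\}\in E$ ($i\ne j$) iff $P_i$ and $P_j$ share a (nonempty) face; for $\{i,j\}\in E$, $F_{ij}=F_{ji}=P_i\cap P_j$ is their maximal common face. $\mathrm{Ext}(\cdot)$ denotes the set of extreme points of a polytope; $\mathrm{Ext}(F_{ij})=\mathrm{Ext}(P_i)\cap \mathrm{Ext}(P_j)$. $A=\{(i,j),(j,i):\{i,j\}\in E\}$. In sums such as $\sum_{(i,j)\in A}$ or $\sum_{(h,i)\in A}$ with $i$ fixed, the sum runs over all $j$ (resp. $h$) for which the pair is an arc. A demand point lying in several cells is assigned to exactly one of them in advance; $s_l$ is the index of the cell assigned to $x_l$. Problem (LocP): $$\inf_{t\in V,\ x\in P_t}\ \sum_{l\in N}w_l D_t(x_l,x),$$ where $D_t(x_l,x)=\omega_{s_l}\|x_l-x\|_{p_{s_l}}$ if $s_l=t$, and otherwise, with $i_0=s_l$ and $i_{k+1}=t$, $$D_t(x_l,x)=\inf\ \ \omega_{s_l}\|x_l-y_{s_li_1}\|_{p_{s_l}}+\sum_{r=1}^k\omega_{i_r}\|y_{i_{r-1}i_r}-y_{i_ri_{r+1}}\|_{p_{i_r}}+\omega_t\|y_{i_kt}-x\|_{p_t},$$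 the infimum being over all simple paths $(s_l,i_1,\dots,i_k,t)$ from $s_l$ to $t$ in $G$ (all vertices distinct, $k\ge0$) and all gate points $y_{i_ri_{r+1}}\in F_{i_ri_{r+1}}$, $r=0,\dots,k$ (value $+\infty$ if there is no such path, and likewise for infeasible minimization problems). *)

theory Defs
  imports "HOL-Analysis.Analysis"
begin

definition lp_norm :: "ereal \<Rightarrow> real ^ 'd \<Rightarrow> real" where
  "lp_norm p x =
     (if p = \<infinity> then infnorm x
      else (\<Sum>k\<in>UNIV. \<bar>x $ k\<bar> powr real_of_ereal p) powr (1 / real_of_ereal p))"

definition Ext :: "'a::real_vector set \<Rightarrow> 'a set" where
  "Ext S = {e. e extreme_point_of S}"

text \<open>Finitely many polytopes meeting face-to-face, with pairwise disjoint interiors. The cells are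
  not required to be full-dimensional or nonempty, and their union is arbitrary.\<close>

definition polytopal_subdivision :: "nat set \<Rightarrow> (nat \<Rightarrow> 'a::euclidean_space set) \<Rightarrow> bool" where
  "polytopal_subdivision I P \<longleftrightarrow>
     finite I \<and> (\<forall>i\<in>I. polytope (P i)) \<and>
     (\<forall>i\<in>I. \<forall>j\<in>I. i \<noteq> j \<longrightarrow>
        interior (P i) \<inter> interior (P j) = {} \<and>
        (P i \<inter> P j) face_of P i \<and> (P i \<inter> P j) face_of P j)"

text \<open>The data of an instance: number \<open>m\<close> of cells, cells \<open>P\<^sub>i\<close>, norm exponents \<open>p\<^sub>i\<close>, cell weights
  \<open>\<omega>\<^sub>i\<close>, number \<open>n\<close> of demand points, demand points \<open>x\<^sub>l\<close>, the assigned cells \<open>s\<^sub>l\<close>, demand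
  weights \<open>w\<^sub>l\<close>. Only the values at \<open>i \<in> {1..m}\<close> and \<open>l \<in> {1..n}\<close> matter.\<close>

record ('d::finite) loc_instance =
  num_cells :: nat
  cell :: "nat \<Rightarrow> (real ^ 'd) set"
  cell_exponent :: "nat \<Rightarrow> ereal"
  cell_weight :: "nat \<Rightarrow> real"
  num_demands :: nat
  demand :: "nat \<Rightarrow> real ^ 'd"
  demand_cell :: "nat \<Rightarrow> nat"
  demand_weight :: "nat \<Rightarrow> real"

definition cells :: "'d::finite loc_instance \<Rightarrow> nat set" where
  "cells I = {1..num_cells I}"

definition demands :: "'d::finite loc_instance \<Rightarrow> nat set" where
  "demands I = {1..num_demands I}"

definition edges :: "'d::finite loc_instance \<Rightarrow> nat set set" where
  "edges I = {{i, j} | i j. i \<in> cells I \<and> j \<in> cells I \<and> i \<noteq> j \<and>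
      (\<exists>F. F \<noteq> {} \<and> F face_of cell I i \<and> F face_of cell I j)}"

definition arcs :: "'d::finite loc_instance \<Rightarrow> (nat \<times> nat) set" where
  "arcs I = {(i, j). {i, j} \<in> edges I}"

definition common_face :: "'d::finite loc_instance \<Rightarrow> nat \<Rightarrow> nat \<Rightarrow> (real ^ 'd) set" where
  "common_face I i j = cell I i \<inter> cell I j"

abbreviation cell_norm :: "'d::finite loc_instance \<Rightarrow> nat \<Rightarrow> real ^ 'd \<Rightarrow> real" where
  "cell_norm I i \<equiv> lp_norm (cell_exponent I i)"


subsection \<open>The location problem\<close>

definition simple_path :: "'d::finite loc_instance \<Rightarrow> nat \<Rightarrow> nat \<Rightarrow> nat list \<Rightarrow> bool" where
  "simple_path I a b vs \<longleftrightarrow>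
     vs \<noteq> [] \<and> hd vs = a \<and> last vs = b \<and> set vs \<subseteq> cells I \<and> distinct vs \<and>
     successively (\<lambda>i j. {i, j} \<in> edges I) vs"

definition path_arcs :: "nat list \<Rightarrow> (nat \<times> nat) set" where
  "path_arcs vs = set (zip vs (tl vs))"

text \<open>Gate points are indexed by arcs; only the values on the arcs of the path matter. The only
  simple path from a cell to itself is the one-vertex path, without gate points.\<close>

definition is_route ::
    "'d::finite loc_instance \<Rightarrow> nat \<Rightarrow> nat \<Rightarrow> nat list \<Rightarrow> (nat \<Rightarrow> nat \<Rightarrow> real ^ 'd) \<Rightarrow> bool" where
  "is_route I l t vs y \<longleftrightarrow>
     simple_path I (demand_cell I l) t vs \<and> (\<forall>(i, j)\<in>path_arcs vs. y i j \<in> common_face I i j)"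

text \<open>Cost of a path \<open>vs = [i\<^sub>0, \<dots>, i\<^sub>k, i\<^bsub>k+1\<^esub>]\<close> with at least two vertices, \<open>i\<^sub>0 = s\<^sub>l\<close> and
  \<open>i\<^bsub>k+1\<^esub> = t\<close>.\<close>

definition route_cost ::
    "'d::finite loc_instance \<Rightarrow> nat \<Rightarrow> nat \<Rightarrow> real ^ 'd \<Rightarrow> nat list \<Rightarrow>
      (nat \<Rightarrow> nat \<Rightarrow> real ^ 'd) \<Rightarrow> real" where
  "route_cost I l t x vs y =
     (let s = demand_cell I l; k = length vs - 2 in
        cell_weight I s * cell_norm I s (demand I l - y s (vs ! 1)) +
        (\<Sum>r = 1..k. cell_weight I (vs ! r) *
            cell_norm I (vs ! r) (y (vs ! (r - 1)) (vs ! r) - y (vs ! r) (vs ! (r + 1)))) +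
        cell_weight I t * cell_norm I t (y (vs ! k) t - x))"

definition loc_dist :: "'d::finite loc_instance \<Rightarrow> nat \<Rightarrow> nat \<Rightarrow> real ^ 'd \<Rightarrow> ereal" where
  "loc_dist I t l x =
     (let s = demand_cell I l in
      if s = t then ereal (cell_weight I s * cell_norm I s (demand I l - x))
      else (INF (vs, y) \<in> {(vs, y). is_route I l t vs y}. ereal (route_cost I l t x vs y)))"

definition LocP_objective :: "'d::finite loc_instance \<Rightarrow> nat \<Rightarrow> real ^ 'd \<Rightarrow> ereal" where
  "LocP_objective I t x = (\<Sum>l\<in>demands I. ereal (demand_weight I l) * loc_dist I t l x)"

definition LocP_value :: "'d::finite loc_instance \<Rightarrow> ereal" where
  "LocP_value I = (INF (t, x) \<in> Sigma (cells I) (cell I). LocP_objective I t x)"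

text \<open>If the optimal value is \<open>\<infinity>\<close>, the problem is infeasible and has no optimal solution.\<close>

definition LocP_optimal :: "'d::finite loc_instance \<Rightarrow> nat \<Rightarrow> real ^ 'd \<Rightarrow> bool" where
  "LocP_optimal I t x \<longleftrightarrow>
     t \<in> cells I \<and> x \<in> cell I t \<and> LocP_objective I t x < \<infinity> \<and> LocP_objective I t x = LocP_value I"

definition LocP_optimal_solution ::
    "'d::finite loc_instance \<Rightarrow> nat \<Rightarrow> real ^ 'd \<Rightarrow> (nat \<Rightarrow> nat list) \<Rightarrow>
      (nat \<Rightarrow> nat \<Rightarrow> nat \<Rightarrow> real ^ 'd) \<Rightarrow> bool" where
  "LocP_optimal_solution I t x vs y \<longleftrightarrow>
     LocP_optimal I t x \<and>
     (\<forall>l\<in>demands I. is_route I l t (vs l) (y l) \<and>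
        (demand_cell I l \<noteq> t \<longrightarrow> ereal (route_cost I l t x (vs l) (y l)) = loc_dist I t l x))"


subsection \<open>The mixed-integer problem\<close>

text \<open>The order of the arguments is that of the indices, superscript first: \<open>z_var v l i j\<close>
  is \<open>z\<^sup>l\<^bsub>ij\<^esub>\<close> and \<open>Phi_var v l h i j e\<close> is \<open>\<Phi>\<^sup>l\<^bsub>hije\<^esub>\<close>. Only the values at the indices
  for which a variable exists in the model are constrained or used.\<close>

record 'e F2_vars =
  u_var :: "nat \<Rightarrow> real"
  mu_var :: "nat \<Rightarrow> 'e \<Rightarrow> real"
  d_var :: "nat \<Rightarrow> nat \<Rightarrow> real"
  z_var :: "nat \<Rightarrow> nat \<Rightarrow> nat \<Rightarrow> real"
  lambda_var :: "nat \<Rightarrow> nat \<Rightarrow> nat \<Rightarrow> 'e \<Rightarrow> real"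
  rho_var :: "nat \<Rightarrow> nat \<Rightarrow> nat \<Rightarrow> nat \<Rightarrow> real"
  Phi_var :: "nat \<Rightarrow> nat \<Rightarrow> nat \<Rightarrow> nat \<Rightarrow> 'e \<Rightarrow> real"
  Psi_var :: "nat \<Rightarrow> nat \<Rightarrow> nat \<Rightarrow> nat \<Rightarrow> 'e \<Rightarrow> real"
  Upsilon_var :: "nat \<Rightarrow> nat \<Rightarrow> nat \<Rightarrow> 'e \<Rightarrow> real"
  Theta_var :: "nat \<Rightarrow> nat \<Rightarrow> nat \<Rightarrow> 'e \<Rightarrow> real"

definition F2_domains :: "'d::finite loc_instance \<Rightarrow> (real ^ 'd) F2_vars \<Rightarrow> bool" where
  "F2_domains I v \<longleftrightarrow>
     (\<forall>i\<in>cells I. u_var v i \<in> {0, 1}) \<and>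
     (\<forall>i\<in>cells I. \<forall>e\<in>Ext (cell I i). mu_var v i e \<ge> 0) \<and>
     (\<forall>l\<in>demands I. \<forall>i\<in>cells I. d_var v l i \<ge> 0) \<and>
     (\<forall>l\<in>demands I. \<forall>(i, j)\<in>arcs I. z_var v l i j \<in> {0, 1}) \<and>
     (\<forall>l\<in>demands I. \<forall>(i, j)\<in>arcs I. \<forall>e\<in>Ext (common_face I i j). lambda_var v l i j e \<ge> 0) \<and>
     (\<forall>l\<in>demands I. \<forall>i\<in>cells I - {demand_cell I l}.
        (\<forall>h j. (h, i) \<in> arcs I \<and> (i, j) \<in> arcs I \<longrightarrow>
           rho_var v l h i j \<ge> 0 \<and>
           (\<forall>e\<in>Ext (common_face I h i). Phi_var v l h i j e \<ge> 0) \<and>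
           (\<forall>e\<in>Ext (common_face I i j). Psi_var v l h i j e \<ge> 0)) \<and>
        (\<forall>h. (h, i) \<in> arcs I \<longrightarrow>
           (\<forall>e\<in>Ext (common_face I h i). Upsilon_var v l h i e \<ge> 0) \<and>
           (\<forall>e\<in>Ext (cell I i). Theta_var v l h i e \<ge> 0)))"

definition F2_location_and_flow :: "'d::finite loc_instance \<Rightarrow> (real ^ 'd) F2_vars \<Rightarrow> bool" where
  "F2_location_and_flow I v \<longleftrightarrow>
     (\<Sum>i\<in>cells I. u_var v i) = 1 \<and>
     (\<forall>i\<in>cells I. (\<Sum>e\<in>Ext (cell I i). mu_var v i e) = u_var v i) \<and>
     (\<forall>l\<in>demands I. let s = demand_cell I l in
        (\<Sum>j | (s, j) \<in> arcs I. z_var v l s j) - (\<Sum>h | (h, s) \<in> arcs I. z_var v l h s)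
          = 1 - u_var v s \<and>
        (\<forall>i\<in>cells I - {s}.
           (\<Sum>j | (i, j) \<in> arcs I. z_var v l i j) - (\<Sum>h | (h, i) \<in> arcs I. z_var v l h i)
             = - u_var v i) \<and>
        (\<forall>i\<in>cells I. (\<Sum>h | (h, i) \<in> arcs I. z_var v l h i) \<le> 1 - u_var v s) \<and>
        (\<forall>i\<in>cells I. (\<Sum>j | (i, j) \<in> arcs I. z_var v l i j) \<le> 1 - u_var v s) \<and>
        (\<forall>(i, j)\<in>arcs I. (\<Sum>e\<in>Ext (common_face I i j). lambda_var v l i j e) = z_var v l i j))"

definition F2_distances :: "'d::finite loc_instance \<Rightarrow> (real ^ 'd) F2_vars \<Rightarrow> bool" where
  "F2_distances I v \<longleftrightarrow>
     (\<forall>l\<in>demands I. let s = demand_cell I l in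
        d_var v l s \<ge>
          (\<Sum>j | (s, j) \<in> arcs I.
             cell_norm I s ((\<Sum>e\<in>Ext (common_face I s j). lambda_var v l s j e *\<^sub>R e)
                            - z_var v l s j *\<^sub>R demand I l))
          + cell_norm I s ((\<Sum>e\<in>Ext (cell I s). mu_var v s e *\<^sub>R e) - u_var v s *\<^sub>R demand I l) \<and>
        (\<forall>i\<in>cells I - {s}.
           d_var v l i \<ge>
             (\<Sum>h | (h, i) \<in> arcs I. \<Sum>j | (i, j) \<in> arcs I.
                cell_norm I i ((\<Sum>e\<in>Ext (common_face I i j). Psi_var v l h i j e *\<^sub>R e)
                               - (\<Sum>e\<in>Ext (common_face I h i). Phi_var v l h i j e *\<^sub>R e)))
             + (\<Sum>h | (h, i) \<in> arcs I.
                cell_norm I i ((\<Sum>e\<in>Ext (cell I i). Theta_var v l h i e *\<^sub>R e)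
                               - (\<Sum>e\<in>Ext (common_face I h i). Upsilon_var v l h i e *\<^sub>R e)))))"

definition F2_linking :: "'d::finite loc_instance \<Rightarrow> (real ^ 'd) F2_vars \<Rightarrow> bool" where
  "F2_linking I v \<longleftrightarrow>
     (\<forall>l\<in>demands I. \<forall>i\<in>cells I - {demand_cell I l}.
        (\<forall>h. (h, i) \<in> arcs I \<longrightarrow>
           (\<Sum>j | (i, j) \<in> arcs I. rho_var v l h i j) + (\<Sum>e\<in>Ext (cell I i). Theta_var v l h i e)
             = z_var v l h i) \<and>
        (\<forall>j. (i, j) \<in> arcs I \<longrightarrow> (\<Sum>h | (h, i) \<in> arcs I. rho_var v l h i j) = z_var v l i j) \<and>
        (\<forall>h j. (h, i) \<in> arcs I \<and> (i, j) \<in> arcs I \<longrightarrow>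
           (\<Sum>e\<in>Ext (common_face I h i). Phi_var v l h i j e) = rho_var v l h i j) \<and>
        (\<forall>h. (h, i) \<in> arcs I \<longrightarrow> (\<forall>e\<in>Ext (common_face I h i).
           (\<Sum>j | (i, j) \<in> arcs I. Phi_var v l h i j e) + Upsilon_var v l h i e
             = lambda_var v l h i e)) \<and>
        (\<forall>h j. (h, i) \<in> arcs I \<and> (i, j) \<in> arcs I \<longrightarrow>
           (\<Sum>e\<in>Ext (common_face I i j). Psi_var v l h i j e) = rho_var v l h i j) \<and>
        (\<forall>j. (i, j) \<in> arcs I \<longrightarrow> (\<forall>e\<in>Ext (common_face I i j).
           (\<Sum>h | (h, i) \<in> arcs I. Psi_var v l h i j e) = lambda_var v l i j e)) \<and>
        (\<Sum>h | (h, i) \<in> arcs I. \<Sum>e\<in>Ext (common_face I h i). Upsilon_var v l h i e) = u_var v i \<and>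
        (\<Sum>h | (h, i) \<in> arcs I. \<Sum>e\<in>Ext (cell I i). Theta_var v l h i e) = u_var v i \<and>
        (\<forall>e\<in>Ext (cell I i). (\<Sum>h | (h, i) \<in> arcs I. Theta_var v l h i e) = mu_var v i e))"

definition F2_feasible :: "'d::finite loc_instance \<Rightarrow> (real ^ 'd) F2_vars \<Rightarrow> bool" where
  "F2_feasible I v \<longleftrightarrow>
     F2_domains I v \<and> F2_location_and_flow I v \<and> F2_distances I v \<and> F2_linking I v"

definition F2_objective :: "'d::finite loc_instance \<Rightarrow> (real ^ 'd) F2_vars \<Rightarrow> real" where
  "F2_objective I v =
     (\<Sum>l\<in>demands I. \<Sum>i\<in>cells I. demand_weight I l * cell_weight I i * d_var v l i)"

definition F2_value :: "'d::finite loc_instance \<Rightarrow> ereal" where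
  "F2_value I = (INF v \<in> {v. F2_feasible I v}. ereal (F2_objective I v))"

definition F2_optimal :: "'d::finite loc_instance \<Rightarrow> (real ^ 'd) F2_vars \<Rightarrow> bool" where
  "F2_optimal I v \<longleftrightarrow> F2_feasible I v \<and> ereal (F2_objective I v) = F2_value I"

definition F2_location :: "'d::finite loc_instance \<Rightarrow> (real ^ 'd) F2_vars \<Rightarrow> nat \<Rightarrow> real ^ 'd" where
  "F2_location I v t = (\<Sum>e\<in>Ext (cell I t). mu_var v t e *\<^sub>R e)"

definition F2_encodes ::
    "'d::finite loc_instance \<Rightarrow> (real ^ 'd) F2_vars \<Rightarrow> nat \<Rightarrow> real ^ 'd \<Rightarrow> (nat \<Rightarrow> nat list) \<Rightarrow>
      (nat \<Rightarrow> nat \<Rightarrow> nat \<Rightarrow> real ^ 'd) \<Rightarrow> bool" where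
  "F2_encodes I v t x vs y \<longleftrightarrow>
     u_var v t = 1 \<and> x = F2_location I v t \<and>
     (\<forall>l\<in>demands I. \<forall>(i, j)\<in>arcs I.
        z_var v l i j = (if (i, j) \<in> path_arcs (vs l) then 1 else 0) \<and>
        ((i, j) \<in> path_arcs (vs l) \<longrightarrow>
           y l i j = (\<Sum>e\<in>Ext (common_face I i j). lambda_var v l i j e *\<^sub>R e)))"

end

(* A route of a demand point is a unit flow along its path, and the lambda- and mu-values are convex
   coordinates of its gate points and of the location; the split variables rho, Phi, Psi, Upsilon,
   Theta are then forced. This turns routes into feasible points of the same cost, near-optimal routes
   handling the case that the infimum over routes is not known to be attained. Conversely, the flow
   of a feasible point contains a simple path from s_l to t, and its lambda-values are gate points
   whose legs are bounded by the d-variables. *)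
theory Submission
  imports Defs
begin

text \<open>The two problems index cost differently: \<open>route_cost\<close> runs along positions
  of a path, the variables \<open>d_var\<close> run over cells. \<open>leg_length\<close> bridges
  this by charging each piece of a route to the cell that it crosses, in the shape of the distance
  constraints. Both directions then become comparisons cell by cell: \<open>d_var\<close> is set
  equal to \<open>leg_length\<close> when a route is encoded, and \<open>leg_length\<close> is
  bounded by \<open>d_var\<close> when a route is extracted. An inequality is all one can expect in
  the second case, since \<open>d_var\<close> may be slack and the flow may carry extra cycles. The
  split variables are forced because a simple path, and likewise the flow under the degree bounds,
  enters and leaves a cell at most once. Every sum in a linking constraint therefore has at most one
  nonzero term. Once the values agree, optimality transfers by squeezing: the cost of an encoded or
  extracted solution lies between two equal optimal values. Convex coordinates of a point need not
  be unique; an encoding may use any choice, because only the resulting combination is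
  compared.\<close>

section \<open>Norms, extreme points and convex coordinates\<close>

lemma lp_norm_nonneg: "0 \<le> lp_norm p x"
  by (simp add: lp_norm_def infnorm_pos_le)

lemma lp_norm_zero: "lp_norm p 0 = 0"
  by (simp add: lp_norm_def infnorm_0)

lemma lp_norm_minus_commute: "lp_norm p (x - y) = lp_norm p (y - x)"
  by (simp add: lp_norm_def infnorm_sub abs_minus_commute)

lemma lp_norm_of_bool: "lp_norm p (of_bool b *\<^sub>R x) = of_bool b * lp_norm p x"
  by (simp add: lp_norm_zero)

lemma finite_Ext:
  fixes S :: "'a::euclidean_space set"
  shows "polytope S \<Longrightarrow> finite (Ext S)"
  unfolding Ext_def by (intro finite_polyhedron_extreme_points polytope_imp_polyhedron)

lemma polytope_eq_hull_Ext:
  fixes S :: "'a::euclidean_space set"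
  shows "polytope S \<Longrightarrow> convex hull Ext S = S"
  unfolding Ext_def
  using Krein_Milman_Minkowski[of S] polytope_imp_compact polytope_imp_convex by blast

text \<open>A chosen system of convex weights on the extreme points. It is meaningful only for a
  point of a polytope; elsewhere the value is arbitrary and has to be masked by a zero
  factor.\<close>

definition coords :: "'a::euclidean_space set \<Rightarrow> 'a \<Rightarrow> 'a \<Rightarrow> real" where
  "coords S x = (SOME c. (\<forall>e\<in>Ext S. 0 \<le> c e) \<and> sum c (Ext S) = 1 \<and> (\<Sum>e\<in>Ext S. c e *\<^sub>R e) = x)"

lemma coords:
  assumes "polytope S" and "x \<in> S"
  shows coords_nonneg: "e \<in> Ext S \<Longrightarrow> 0 \<le> coords S x e"
    and sum_coords: "sum (coords S x) (Ext S) = 1"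
    and coords_combination: "(\<Sum>e\<in>Ext S. coords S x e *\<^sub>R e) = x"
proof -
  have "x \<in> convex hull Ext S"
    using assms by (simp add: polytope_eq_hull_Ext)
  then have "\<exists>c. (\<forall>e\<in>Ext S. 0 \<le> c e) \<and> sum c (Ext S) = 1 \<and> (\<Sum>e\<in>Ext S. c e *\<^sub>R e) = x"
    using convex_hull_finite[OF finite_Ext[OF assms(1)]] by auto
  from someI_ex[OF this]
  show "e \<in> Ext S \<Longrightarrow> 0 \<le> coords S x e" "sum (coords S x) (Ext S) = 1"
    "(\<Sum>e\<in>Ext S. coords S x e *\<^sub>R e) = x"
    unfolding coords_def by blast+
qed

lemma convex_combination_in_polytope:
  fixes S :: "'a::euclidean_space set"
  assumes "polytope S" and "\<And>e. e \<in> Ext S \<Longrightarrow> 0 \<le> c e" and "sum c (Ext S) = 1"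
  shows "(\<Sum>e\<in>Ext S. c e *\<^sub>R e) \<in> S"
proof -
  have "(\<Sum>e\<in>Ext S. c e *\<^sub>R e) \<in> convex hull Ext S"
    using assms(2,3) convex_hull_finite[OF finite_Ext[OF assms(1)]] by auto
  then show ?thesis using assms(1) by (simp add: polytope_eq_hull_Ext)
qed

section \<open>Arcs of the adjacency graph and degrees along a simple path\<close>

lemma arcs_in_cells: "(i, j) \<in> arcs I \<Longrightarrow> i \<in> cells I \<and> j \<in> cells I"
  unfolding arcs_def edges_def by (auto simp: doubleton_eq_iff)

lemma finite_cells: "finite (cells I)"
  by (simp add: cells_def)

lemma finite_successors: "finite {j. (i, j) \<in> arcs I}"
  by (rule finite_subset[OF _ finite_cells[of I]]) (auto dest: arcs_in_cells)

lemma finite_predecessors: "finite {h. (h, i) \<in> arcs I}"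
  by (rule finite_subset[OF _ finite_cells[of I]]) (auto dest: arcs_in_cells)

lemma polytope_common_face:
  assumes "polytopal_subdivision (cells I) (cell I)" and "(i, j) \<in> arcs I"
  shows "polytope (common_face I i j)"
  using assms arcs_in_cells[OF assms(2)] unfolding polytopal_subdivision_def common_face_def
  by (simp add: polytope_Int)

lemma path_arcs_conv_nth:
  "(i, j) \<in> path_arcs vs \<longleftrightarrow> (\<exists>r. Suc r < length vs \<and> i = vs ! r \<and> j = vs ! Suc r)"
  unfolding path_arcs_def set_zip by (cases vs) auto

lemma path_arcs_nth_left:
  assumes "distinct vs" and "r < length vs"
  shows "(vs ! r, j) \<in> path_arcs vs \<longleftrightarrow> Suc r < length vs \<and> j = vs ! Suc r"
  using assms by (auto simp: path_arcs_conv_nth nth_eq_iff_index_eq)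

lemma path_arcs_nth_right:
  assumes "distinct vs" and "r < length vs"
  shows "(h, vs ! r) \<in> path_arcs vs \<longleftrightarrow> 0 < r \<and> h = vs ! (r - 1)"
  using assms
  by (cases r) (auto simp: path_arcs_conv_nth nth_eq_iff_index_eq)

lemma path_arcs_in_set: "(i, j) \<in> path_arcs vs \<Longrightarrow> i \<in> set vs \<and> j \<in> set vs"
  by (auto simp: path_arcs_conv_nth)

lemma path_arcs_subset_arcs:
  assumes "simple_path I a b vs"
  shows "path_arcs vs \<subseteq> arcs I"
  using assms unfolding simple_path_def
  by (auto simp: path_arcs_conv_nth successively_conv_nth arcs_def)

text \<open>The model sums over all neighbours of a cell, while a path without repeated vertices has
  one successor at most. The indicator of the path keeps just that term.\<close>

lemma sum_path_successors:
  fixes f :: "nat \<Rightarrow> real"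
  assumes "simple_path I a b vs" and "r < length vs"
  shows "(\<Sum>j | (vs ! r, j) \<in> arcs I. of_bool ((vs ! r, j) \<in> path_arcs vs) * f j) =
    (if Suc r < length vs then f (vs ! Suc r) else 0)"
proof -
  have d: "distinct vs" using assms(1) by (simp add: simple_path_def)
  have "Suc r < length vs \<Longrightarrow> (vs ! r, vs ! Suc r) \<in> arcs I"
    using path_arcs_subset_arcs[OF assms(1)] path_arcs_nth_left[OF d assms(2)] by blast
  then show ?thesis
    using finite_successors[of "vs ! r" I]
    by (simp add: path_arcs_nth_left[OF d assms(2)] of_bool_def if_distrib[of "\<lambda>c. c * f _"] cong: if_cong)
qed

lemma sum_path_predecessors:
  fixes f :: "nat \<Rightarrow> real"
  assumes "simple_path I a b vs" and "r < length vs"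
  shows "(\<Sum>h | (h, vs ! r) \<in> arcs I. of_bool ((h, vs ! r) \<in> path_arcs vs) * f h) =
    (if 0 < r then f (vs ! (r - 1)) else 0)"
proof -
  have d: "distinct vs" using assms(1) by (simp add: simple_path_def)
  have "0 < r \<Longrightarrow> (vs ! (r - 1), vs ! r) \<in> arcs I"
    using path_arcs_subset_arcs[OF assms(1)] path_arcs_nth_right[OF d assms(2)] by blast
  then show ?thesis
    using finite_predecessors[of "vs ! r" I]
    by (simp add: path_arcs_nth_right[OF d assms(2)] of_bool_def if_distrib[of "\<lambda>c. c * f _"] cong: if_cong)
qed

text \<open>Together with \<open>path_in_degree\<close> this is the statement that a simple path is
  a unit flow: the difference of the two degrees is 1 at the start, -1 at the end and 0 elsewhere,
  with everything cancelling when the ends coincide.\<close>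

lemma path_out_degree:
  assumes "simple_path I a b vs"
  shows "(\<Sum>j | (i, j) \<in> arcs I. of_bool ((i, j) \<in> path_arcs vs)) = (of_bool (i \<in> set vs \<and> i \<noteq> b) :: real)"
proof (cases "i \<in> set vs")
  case True
  then obtain r where r: "r < length vs" "i = vs ! r" by (metis in_set_conv_nth)
  moreover have "vs ! r = b \<longleftrightarrow> \<not> Suc r < length vs"
    using assms r by (auto simp: simple_path_def last_conv_nth nth_eq_iff_index_eq)
  ultimately show ?thesis
    using sum_path_successors[OF assms r(1), of "\<lambda>_. 1"] True by (simp add: of_bool_def)
next
  case False
  then show ?thesis by (auto intro!: sum.neutral dest: path_arcs_in_set)
qed

lemma path_in_degree:
  assumes "simple_path I a b vs"
  shows "(\<Sum>h | (h, i) \<in> arcs I. of_bool ((h, i) \<in> path_arcs vs)) = (of_bool (i \<in> set vs \<and> i \<noteq> a) :: real)"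
proof (cases "i \<in> set vs")
  case True
  then obtain r where r: "r < length vs" "i = vs ! r" by (metis in_set_conv_nth)
  moreover have "vs ! r = a \<longleftrightarrow> \<not> 0 < r"
    using assms r by (auto simp: simple_path_def hd_conv_nth nth_eq_iff_index_eq)
  ultimately show ?thesis
    using sum_path_predecessors[OF assms r(1), of "\<lambda>_. 1"] True by (simp add: of_bool_def)
next
  case False
  then show ?thesis by (auto intro!: sum.neutral dest: path_arcs_in_set)
qed

text \<open>The part of a route inside cell \<open>i\<close>, written as sums over all arcs so as to match the right-hand
  sides of the distance constraints term by term; it vanishes off the route.\<close>

definition leg_length ::
    "'d::finite loc_instance \<Rightarrow> nat \<Rightarrow> nat \<Rightarrow> real ^ 'd \<Rightarrow> nat list \<Rightarrow>
      (nat \<Rightarrow> nat \<Rightarrow> real ^ 'd) \<Rightarrow> nat \<Rightarrow> real" where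
  "leg_length I l t x vs y i =
     (if i = demand_cell I l then
        (\<Sum>j | (i, j) \<in> arcs I.
           of_bool ((i, j) \<in> path_arcs vs) * cell_norm I i (y i j - demand I l))
        + of_bool (i = t) * cell_norm I i (x - demand I l)
      else
        (\<Sum>h | (h, i) \<in> arcs I. \<Sum>j | (i, j) \<in> arcs I.
           of_bool ((h, i) \<in> path_arcs vs \<and> (i, j) \<in> path_arcs vs) * cell_norm I i (y i j - y h i))
        + (\<Sum>h | (h, i) \<in> arcs I.
           of_bool ((h, i) \<in> path_arcs vs \<and> i = t) * cell_norm I i (x - y h i)))"

lemma leg_length_nonneg: "0 \<le> leg_length I l t x vs y i"
  unfolding leg_length_def by (simp add: sum_nonneg lp_norm_nonneg)

lemma leg_length_off_path:
  assumes "simple_path I (demand_cell I l) t vs" and "i \<notin> set vs"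
  shows "leg_length I l t x vs y i = 0"
proof -
  have "t \<in> set vs" using assms(1) by (auto simp: simple_path_def)
  moreover have "(h, i) \<notin> path_arcs vs" "(i, j) \<notin> path_arcs vs" for h j
    using assms(2) path_arcs_in_set by blast+
  moreover have "demand_cell I l \<in> set vs"
    using assms(1) by (metis simple_path_def list.set_sel(1))
  ultimately show ?thesis
    using assms(2) by (auto simp: leg_length_def)
qed

lemma leg_length_start:
  assumes "simple_path I (demand_cell I l) t vs" and "demand_cell I l \<noteq> t"
  shows "leg_length I l t x vs y (vs ! 0) =
    cell_norm I (demand_cell I l) (demand I l - y (demand_cell I l) (vs ! 1))"
proof -
  have "vs \<noteq> []" and s: "vs ! 0 = demand_cell I l" and t: "last vs = t"
    using assms(1) by (auto simp: simple_path_def hd_conv_nth)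
  then have len: "Suc 0 < length vs"
    using assms(2) by (cases vs) auto
  have "0 < length vs" using len by linarith
  from sum_path_successors[OF assms(1) this] show ?thesis
    using len assms(2) s
    by (simp add: leg_length_def lp_norm_minus_commute)
qed

lemma leg_length_later:
  assumes path: "simple_path I (demand_cell I l) t vs" and r: "0 < r" "r < length vs"
  shows "leg_length I l t x vs y (vs ! r) =
    (if Suc r < length vs then cell_norm I (vs ! r) (y (vs ! (r - 1)) (vs ! r) - y (vs ! r) (vs ! Suc r))
     else cell_norm I t (y (vs ! (r - 1)) t - x))"
proof -
  have d: "distinct vs" and s: "vs ! 0 = demand_cell I l" and t: "last vs = t" and ne: "vs \<noteq> []"
    using path by (auto simp: simple_path_def hd_conv_nth)
  have "vs ! r \<noteq> demand_cell I l"
    using d r s ne by (metis length_greater_0_conv less_irrefl nth_eq_iff_index_eq)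
  moreover have rt: "vs ! r = t \<longleftrightarrow> \<not> Suc r < length vs"
    using d r t ne by (auto simp: last_conv_nth nth_eq_iff_index_eq)
  \<comment> \<open>Writing the indicator of a conjunction as a product nests the sums, so that
    predecessor and successor can be resolved independently.\<close>
  ultimately have "leg_length I l t x vs y (vs ! r) =
     (\<Sum>h | (h, vs ! r) \<in> arcs I. of_bool ((h, vs ! r) \<in> path_arcs vs) *
        (\<Sum>j | (vs ! r, j) \<in> arcs I. of_bool ((vs ! r, j) \<in> path_arcs vs) *
            cell_norm I (vs ! r) (y (vs ! r) j - y h (vs ! r))))
     + (\<Sum>h | (h, vs ! r) \<in> arcs I. of_bool ((h, vs ! r) \<in> path_arcs vs) *
        (of_bool (vs ! r = t) * cell_norm I (vs ! r) (x - y h (vs ! r))))"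
    by (simp add: leg_length_def of_bool_conj sum_distrib_left mult.assoc)
  also have "\<dots> = (if Suc r < length vs
       then cell_norm I (vs ! r) (y (vs ! (r - 1)) (vs ! r) - y (vs ! r) (vs ! Suc r))
       else cell_norm I t (y (vs ! (r - 1)) t - x))"
    unfolding sum_path_successors[OF path r(2)] sum_path_predecessors[OF path r(2)]
    using r rt by (auto simp: lp_norm_minus_commute)
  finally show ?thesis .
qed

text \<open>A simple path visits each cell at most once, so passing from cells to positions in the
  list is a bijection, and cells off the path contribute 0. Both cases in the definition of the
  distance are covered by the same sum.\<close>

lemma sum_leg_lengths:
  assumes path: "simple_path I (demand_cell I l) t vs"
  shows "(\<Sum>i\<in>cells I. cell_weight I i * leg_length I l t x vs y i) =
    (if demand_cell I l = t then cell_weight I t * cell_norm I t (demand I l - x)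
     else route_cost I l t x vs y)"
proof -
  let ?f = "\<lambda>i. cell_weight I i * leg_length I l t x vs y i"
  have d: "distinct vs" and s: "vs ! 0 = demand_cell I l" and t: "last vs = t" and ne: "vs \<noteq> []"
    and sub: "set vs \<subseteq> cells I"
    using path by (auto simp: simple_path_def hd_conv_nth)
  have "sum ?f (cells I) = sum ?f (set vs)"
    using sub by (intro sum.mono_neutral_right finite_cells) (auto simp: leg_length_off_path[OF path])
  also have "\<dots> = (\<Sum>r<length vs. ?f (vs ! r))"
    using bij_betw_nth[OF d refl refl] by (rule sum.reindex_bij_betw[symmetric])
  finally have sum: "sum ?f (cells I) = (\<Sum>r<length vs. ?f (vs ! r))" .
  show ?thesis
  proof (cases "demand_cell I l = t")
    case True
    \<comment> \<open>A list without repetitions whose first and last entries coincide has a single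
      vertex, so only the location term of the leg survives.\<close>
    have "vs ! 0 = vs ! (length vs - 1)" using s t ne True by (simp add: last_conv_nth)
    then have "length vs = 1" using d ne nth_eq_iff_index_eq[OF d, of 0 "length vs - 1"]
      by (cases vs) auto
    then obtain "vs = [t]" using t by (cases vs) auto
    then show ?thesis using sum True
      by (simp add: leg_length_def path_arcs_def lp_norm_minus_commute)
  next
    case False
    then have "2 \<le> length vs" using s t ne by (cases vs; cases "tl vs") auto
    \<comment> \<open>Here \<open>k\<close> counts the intermediate cells, in agreement with
      \<open>length vs - 2\<close> in \<open>route_cost\<close>.\<close>
    then obtain k where k: "length vs = Suc (Suc k)"
      by (metis add_2_eq_Suc le_Suc_ex)
    have last: "vs ! Suc k = t" using t ne k by (simp add: last_conv_nth)
    have "(\<Sum>r<length vs. ?f (vs ! r)) = ?f (vs ! 0) + (\<Sum>r=1..k. ?f (vs ! r)) + ?f (vs ! Suc k)"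
      unfolding k lessThan_Suc_atMost atMost_atLeast0
      by (simp add: sum.atLeast_Suc_atMost)
    moreover have "(\<Sum>r=1..k. ?f (vs ! r)) = (\<Sum>r=1..k. cell_weight I (vs ! r) *
            cell_norm I (vs ! r) (y (vs ! (r - 1)) (vs ! r) - y (vs ! r) (vs ! (r + 1))))"
      using k by (intro sum.cong) (auto simp: leg_length_later[OF path])
    moreover have "?f (vs ! Suc k) = cell_weight I t * cell_norm I t (y (vs ! k) t - x)"
      using leg_length_later[OF path, of "Suc k"] k last by simp
    moreover have "?f (vs ! 0) = cell_weight I (demand_cell I l) *
      cell_norm I (demand_cell I l) (demand I l - y (demand_cell I l) (vs ! 1))"
      using leg_length_start[OF path False] s by simp
    ultimately show ?thesis
      using False sum k by (simp add: route_cost_def Let_def)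
  qed
qed

section \<open>Distances as infima of a single cost over routes\<close>

definition travel_cost ::
    "'d::finite loc_instance \<Rightarrow> nat \<Rightarrow> nat \<Rightarrow> real ^ 'd \<Rightarrow> nat list \<Rightarrow>
      (nat \<Rightarrow> nat \<Rightarrow> real ^ 'd) \<Rightarrow> real" where
  "travel_cost I l t x vs y = (\<Sum>i\<in>cells I. cell_weight I i * leg_length I l t x vs y i)"

lemma travel_cost_nonneg:
  assumes "\<forall>i\<in>cells I. 0 < cell_weight I i"
  shows "0 \<le> travel_cost I l t x vs y"
  unfolding travel_cost_def using assms
  by (intro sum_nonneg mult_nonneg_nonneg leg_length_nonneg) (simp add: less_imp_le)

text \<open>This removes the case distinction between a demand point in the target cell and one
  outside it from all later arguments.\<close>

lemma loc_dist_eq_INF_travel_cost: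
  assumes "demand_cell I l \<in> cells I"
  shows "loc_dist I t l x =
    (INF (vs, y) \<in> {(vs, y). is_route I l t vs y}. ereal (travel_cost I l t x vs y))"
proof (cases "demand_cell I l = t")
  case True
  have "ereal (travel_cost I l t x vs y) = loc_dist I t l x" if "is_route I l t vs y" for vs y
    using that sum_leg_lengths[of I l t vs x y] True
    by (simp add: is_route_def loc_dist_def travel_cost_def)
  \<comment> \<open>A witness is required: the infimum of a constant over an empty set of routes
    would be infinite.\<close>
  moreover have "is_route I l t [t] (\<lambda>_ _. 0)"
    using assms True by (simp add: is_route_def simple_path_def path_arcs_def)
  ultimately have "(INF (vs, y) \<in> {(vs, y). is_route I l t vs y}. ereal (travel_cost I l t x vs y))
      = loc_dist I t l x"
    by (subst INF_eq_const[where x = "loc_dist I t l x"]) auto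
  then show ?thesis by (rule sym)
next
  case False
  then show ?thesis
    unfolding loc_dist_def Let_def
    by (auto intro!: INF_cong simp: is_route_def travel_cost_def sum_leg_lengths)
qed

lemma loc_dist_le_travel_cost:
  assumes "demand_cell I l \<in> cells I" and "is_route I l t vs y"
  shows "loc_dist I t l x \<le> ereal (travel_cost I l t x vs y)"
  unfolding loc_dist_eq_INF_travel_cost[OF assms(1)] using assms(2)
  by (intro INF_lower2[of "(vs, y)"]) auto

lemma loc_dist_nonneg:
  assumes "\<forall>i\<in>cells I. 0 < cell_weight I i" and "demand_cell I l \<in> cells I"
  shows "0 \<le> loc_dist I t l x"
  unfolding loc_dist_eq_INF_travel_cost[OF assms(2)]
  by (rule INF_greatest) (auto simp: travel_cost_nonneg[OF assms(1)])

subsection \<open>From routes to feasible points\<close>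

text \<open>Each variable is an indicator times a coordinate of a point: \<open>Phi_var\<close> and
  \<open>Upsilon_var\<close> use the gate where cell \<open>i\<close> is entered,
  \<open>Psi_var\<close> the gate where it is left, \<open>Theta_var\<close> the location. The
  indicators mask the arbitrary values of \<open>coords\<close> off the route.\<close>

definition route_vars ::
    "'d::finite loc_instance \<Rightarrow> nat \<Rightarrow> real ^ 'd \<Rightarrow> (nat \<Rightarrow> nat list) \<Rightarrow>
      (nat \<Rightarrow> nat \<Rightarrow> nat \<Rightarrow> real ^ 'd) \<Rightarrow> (real ^ 'd) F2_vars" where
  "route_vars I t x vs y =
     (let on = (\<lambda>l i j. (i, j) \<in> path_arcs (vs l));
          gate = (\<lambda>l i j. coords (common_face I i j) (y l i j));
          loc = coords (cell I t) x in
      \<lparr>u_var = \<lambda>i. of_bool (i = t),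
       mu_var = \<lambda>i e. of_bool (i = t) * loc e,
       d_var = \<lambda>l i. leg_length I l t x (vs l) (y l) i,
       z_var = \<lambda>l i j. of_bool (on l i j),
       lambda_var = \<lambda>l i j e. of_bool (on l i j) * gate l i j e,
       rho_var = \<lambda>l h i j. of_bool (on l h i \<and> on l i j),
       Phi_var = \<lambda>l h i j e. of_bool (on l h i \<and> on l i j) * gate l h i e,
       Psi_var = \<lambda>l h i j e. of_bool (on l h i \<and> on l i j) * gate l i j e,
       Upsilon_var = \<lambda>l h i e. of_bool (on l h i \<and> i = t) * gate l h i e,
       Theta_var = \<lambda>l h i e. of_bool (on l h i \<and> i = t) * loc e\<rparr>)"

context
  fixes I :: "'d::finite loc_instance" and t x vs y
  assumes subdivision: "polytopal_subdivision (cells I) (cell I)"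
    and location: "t \<in> cells I" "x \<in> cell I t"
    and routes: "\<forall>l\<in>demands I. is_route I l t (vs l) (y l)"
begin

lemma polytope_location: "polytope (cell I t)"
  using subdivision location by (simp add: polytopal_subdivision_def)

lemmas loc_coords = coords[OF polytope_location location(2)]

lemma simple_route: "l \<in> demands I \<Longrightarrow> simple_path I (demand_cell I l) t (vs l)"
  using routes by (simp add: is_route_def)

lemma route_gate:
  assumes "l \<in> demands I" and "(i, j) \<in> path_arcs (vs l)"
  shows "polytope (common_face I i j)" and "y l i j \<in> common_face I i j"
  using assms routes polytope_common_face[OF subdivision, of i j]
    path_arcs_subset_arcs[OF simple_route[OF assms(1)]]
  by (auto simp: is_route_def)

text \<open>The Boolean \<open>b\<close> is kept general because the same gate weights occur under
  several indicators: the arc itself, the arc together with a following or preceding arc, or the arc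
  together with arrival at \<open>t\<close>.\<close>

lemma weighted_gate_coords:
  assumes "l \<in> demands I" and "b \<Longrightarrow> (i, j) \<in> path_arcs (vs l)"
  shows gate_coords_nonneg:
      "e \<in> Ext (common_face I i j) \<Longrightarrow> 0 \<le> of_bool b * coords (common_face I i j) (y l i j) e"
    and sum_gate_coords:
      "(\<Sum>e\<in>Ext (common_face I i j). of_bool b * coords (common_face I i j) (y l i j) e) = of_bool b"
    and gate_coords_combination:
      "(\<Sum>e\<in>Ext (common_face I i j). (of_bool b * coords (common_face I i j) (y l i j) e) *\<^sub>R e)
        = of_bool b *\<^sub>R y l i j"
  using coords[OF route_gate[OF assms(1)], of i j] assms(2)
  by (cases b; simp add: sum_distrib_left[symmetric])+

lemma weighted_loc_coords:
  assumes "b \<Longrightarrow> i = t"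
  shows loc_coords_nonneg: "e \<in> Ext (cell I i) \<Longrightarrow> 0 \<le> of_bool b * coords (cell I t) x e"
    and sum_loc_coords: "(\<Sum>e\<in>Ext (cell I i). of_bool b * coords (cell I t) x e) = of_bool b"
    and loc_coords_combination:
      "(\<Sum>e\<in>Ext (cell I i). (of_bool b * coords (cell I t) x e) *\<^sub>R e) = of_bool b *\<^sub>R x"
  using loc_coords assms by (cases b; simp add: sum_distrib_left[symmetric])+

lemma route_vars_domains: "F2_domains I (route_vars I t x vs y)"
  unfolding F2_domains_def route_vars_def Let_def F2_vars.simps
  using gate_coords_nonneg[where b = True] loc_coords_nonneg[where b = True]
  by (auto intro!: leg_length_nonneg)

lemma route_endpoints:
  "l \<in> demands I \<Longrightarrow> demand_cell I l \<in> set (vs l) \<and> t \<in> set (vs l)"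
  using simple_route[of l] unfolding simple_path_def by (metis list.set_sel(1) last_in_set)

text \<open>Needed for the degree bounds: when the demand point already lies in the target cell they
  are 0, so the route may not use any arc.\<close>

lemma route_stays:
  "l \<in> demands I \<Longrightarrow> demand_cell I l = t \<Longrightarrow> set (vs l) = {t}"
  using simple_route[of l] unfolding simple_path_def
  by (cases "vs l") (simp, metis distinct.simps(2) empty_set last.simps last_in_set list.sel(1) list.simps(15))

lemma route_vars_location_and_flow: "F2_location_and_flow I (route_vars I t x vs y)"
  unfolding F2_location_and_flow_def route_vars_def Let_def F2_vars.simps
proof (intro conjI ballI)
  show "(\<Sum>i\<in>cells I. of_bool (i = t)) = (1::real)"
    using location finite_cells[of I] by (simp add: of_bool_def)
  show "(\<Sum>e\<in>Ext (cell I i). of_bool (i = t) * coords (cell I t) x e) = of_bool (i = t)" for i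
    by (rule sum_loc_coords)
next
  fix l assume l: "l \<in> demands I"
  note deg = path_out_degree[OF simple_route[OF l]] path_in_degree[OF simple_route[OF l]]
  show "(\<Sum>j | (demand_cell I l, j) \<in> arcs I. of_bool ((demand_cell I l, j) \<in> path_arcs (vs l))) -
      (\<Sum>h | (h, demand_cell I l) \<in> arcs I. of_bool ((h, demand_cell I l) \<in> path_arcs (vs l))) =
      1 - (of_bool (demand_cell I l = t) :: real)"
    unfolding deg using route_endpoints[OF l] by simp
  fix i
  show "(\<Sum>h | (h, i) \<in> arcs I. of_bool ((h, i) \<in> path_arcs (vs l))) \<le> 1 - (of_bool (demand_cell I l = t) :: real)"
    unfolding deg using route_stays[OF l] by (auto simp: of_bool_def)
  show "(\<Sum>j | (i, j) \<in> arcs I. of_bool ((i, j) \<in> path_arcs (vs l))) \<le> 1 - (of_bool (demand_cell I l = t) :: real)"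
    unfolding deg using route_stays[OF l] by (auto simp: of_bool_def)
  assume "i \<in> cells I - {demand_cell I l}"
  then show "(\<Sum>j | (i, j) \<in> arcs I. of_bool ((i, j) \<in> path_arcs (vs l))) -
      (\<Sum>h | (h, i) \<in> arcs I. of_bool ((h, i) \<in> path_arcs (vs l))) = - (of_bool (i = t) :: real)"
    unfolding deg using route_endpoints[OF l] by (auto simp: of_bool_def)
next
  fix l a assume l: "l \<in> demands I"
  show "case a of (i, j) \<Rightarrow> (\<Sum>e\<in>Ext (common_face I i j).
      of_bool ((i, j) \<in> path_arcs (vs l)) * coords (common_face I i j) (y l i j) e) =
      of_bool ((i, j) \<in> path_arcs (vs l))"
    by (cases a) (simp only: prod.case sum_gate_coords[OF l])
qed

lemma route_vars_distances: "F2_distances I (route_vars I t x vs y)"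
  unfolding F2_distances_def route_vars_def Let_def F2_vars.simps
proof (intro ballI conjI)
  fix l assume l: "l \<in> demands I"
  let ?s = "demand_cell I l"
  have gate: "(\<Sum>e\<in>Ext (common_face I i j). (of_bool ((i, j) \<in> path_arcs (vs l)) *
      coords (common_face I i j) (y l i j) e) *\<^sub>R e) = of_bool ((i, j) \<in> path_arcs (vs l)) *\<^sub>R y l i j" for i j
    by (rule gate_coords_combination[OF l])
  have gates:
    "(\<Sum>e\<in>Ext (common_face I h i). (of_bool ((h, i) \<in> path_arcs (vs l) \<and> (i, j) \<in> path_arcs (vs l)) *
      coords (common_face I h i) (y l h i) e) *\<^sub>R e) =
      of_bool ((h, i) \<in> path_arcs (vs l) \<and> (i, j) \<in> path_arcs (vs l)) *\<^sub>R y l h i"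
    "(\<Sum>e\<in>Ext (common_face I i j). (of_bool ((h, i) \<in> path_arcs (vs l) \<and> (i, j) \<in> path_arcs (vs l)) *
      coords (common_face I i j) (y l i j) e) *\<^sub>R e) =
      of_bool ((h, i) \<in> path_arcs (vs l) \<and> (i, j) \<in> path_arcs (vs l)) *\<^sub>R y l i j"
    "(\<Sum>e\<in>Ext (common_face I h i). (of_bool ((h, i) \<in> path_arcs (vs l) \<and> i = t) *
      coords (common_face I h i) (y l h i) e) *\<^sub>R e) =
      of_bool ((h, i) \<in> path_arcs (vs l) \<and> i = t) *\<^sub>R y l h i" for h i j
    by (rule gate_coords_combination[OF l]; blast)+
  have loc: "(\<Sum>e\<in>Ext (cell I i). (of_bool (i = t) * coords (cell I t) x e) *\<^sub>R e) = of_bool (i = t) *\<^sub>R x"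
    "(\<Sum>e\<in>Ext (cell I i). (of_bool ((h, i) \<in> path_arcs (vs l) \<and> i = t) * coords (cell I t) x e) *\<^sub>R e) =
     of_bool ((h, i) \<in> path_arcs (vs l) \<and> i = t) *\<^sub>R x" for h i
    by (rule loc_coords_combination; blast)+
  note simps = gate gates loc scaleR_diff_right[symmetric] lp_norm_of_bool leg_length_def
  show "(\<Sum>j | (?s, j) \<in> arcs I. cell_norm I ?s
           ((\<Sum>e\<in>Ext (common_face I ?s j). (of_bool ((?s, j) \<in> path_arcs (vs l)) *
               coords (common_face I ?s j) (y l ?s j) e) *\<^sub>R e)
             - of_bool ((?s, j) \<in> path_arcs (vs l)) *\<^sub>R demand I l))
        + cell_norm I ?s ((\<Sum>e\<in>Ext (cell I ?s). (of_bool (?s = t) * coords (cell I t) x e) *\<^sub>R e)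
            - of_bool (?s = t) *\<^sub>R demand I l)
        \<le> leg_length I l t x (vs l) (y l) ?s"
    unfolding simps by simp
  fix i assume "i \<in> cells I - {?s}"
  then have i: "i \<noteq> ?s" by blast
  show "(\<Sum>h | (h, i) \<in> arcs I. \<Sum>j | (i, j) \<in> arcs I. cell_norm I i
          ((\<Sum>e\<in>Ext (common_face I i j). (of_bool ((h, i) \<in> path_arcs (vs l) \<and> (i, j) \<in> path_arcs (vs l)) *
              coords (common_face I i j) (y l i j) e) *\<^sub>R e) -
           (\<Sum>e\<in>Ext (common_face I h i). (of_bool ((h, i) \<in> path_arcs (vs l) \<and> (i, j) \<in> path_arcs (vs l)) *
              coords (common_face I h i) (y l h i) e) *\<^sub>R e)))
      + (\<Sum>h | (h, i) \<in> arcs I. cell_norm I i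
          ((\<Sum>e\<in>Ext (cell I i). (of_bool ((h, i) \<in> path_arcs (vs l) \<and> i = t) * coords (cell I t) x e) *\<^sub>R e) -
           (\<Sum>e\<in>Ext (common_face I h i). (of_bool ((h, i) \<in> path_arcs (vs l) \<and> i = t) *
              coords (common_face I h i) (y l h i) e) *\<^sub>R e)))
      \<le> leg_length I l t x (vs l) (y l) i"
    unfolding simps if_not_P[OF i] by (rule order.refl)
qed

context
  fixes l i
  assumes l: "l \<in> demands I" and i: "i \<in> cells I - {demand_cell I l}"
begin

text \<open>Weight \<open>c\<close> arriving in cell \<open>i\<close> either continues along the
  unique next arc or stops, the latter exactly when \<open>i = t\<close>. With \<open>c\<close> a
  coordinate this is the split of \<open>lambda_var\<close> into \<open>Phi_var\<close> and
  \<open>Upsilon_var\<close>.\<close>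

lemma sum_arcs_out:
  "(\<Sum>j | (i, j) \<in> arcs I. of_bool ((h, i) \<in> path_arcs (vs l) \<and> (i, j) \<in> path_arcs (vs l)) * c)
    + of_bool ((h, i) \<in> path_arcs (vs l) \<and> i = t) * c = of_bool ((h, i) \<in> path_arcs (vs l)) * (c :: real)"
  using path_out_degree[OF simple_route[OF l], of i] path_arcs_in_set[of h i "vs l"]
  by (cases "(h, i) \<in> path_arcs (vs l)")
    (auto simp: sum_distrib_right[symmetric] of_bool_def[of "i = t"] of_bool_def[of "i \<noteq> t"])

text \<open>Since \<open>i\<close> is not the start, a route that leaves \<open>i\<close> has
  entered it by exactly one arc.\<close>

lemma sum_arcs_in:
  "(\<Sum>h | (h, i) \<in> arcs I. of_bool ((h, i) \<in> path_arcs (vs l) \<and> (i, j) \<in> path_arcs (vs l)) * c)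
    = of_bool ((i, j) \<in> path_arcs (vs l)) * (c :: real)"
  using path_in_degree[OF simple_route[OF l], of i] path_arcs_in_set[of i j "vs l"] i
  by (cases "(i, j) \<in> path_arcs (vs l)") (auto simp: sum_distrib_right[symmetric])

lemma sum_arcs_end:
  "(\<Sum>h | (h, i) \<in> arcs I. of_bool ((h, i) \<in> path_arcs (vs l) \<and> i = t) * c) = of_bool (i = t) * (c :: real)"
  using path_in_degree[OF simple_route[OF l], of i] route_endpoints[OF l] i
  by (cases "i = t") (auto simp: sum_distrib_right[symmetric])

lemma sum_gates:
  "(\<Sum>e\<in>Ext (common_face I h i). of_bool ((h, i) \<in> path_arcs (vs l) \<and> (i, j) \<in> path_arcs (vs l)) *
    coords (common_face I h i) (y l h i) e) = of_bool ((h, i) \<in> path_arcs (vs l) \<and> (i, j) \<in> path_arcs (vs l))"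
  "(\<Sum>e\<in>Ext (common_face I i j). of_bool ((h, i) \<in> path_arcs (vs l) \<and> (i, j) \<in> path_arcs (vs l)) *
    coords (common_face I i j) (y l i j) e) = of_bool ((h, i) \<in> path_arcs (vs l) \<and> (i, j) \<in> path_arcs (vs l))"
  "(\<Sum>e\<in>Ext (common_face I h i). of_bool ((h, i) \<in> path_arcs (vs l) \<and> i = t) *
    coords (common_face I h i) (y l h i) e) = of_bool ((h, i) \<in> path_arcs (vs l) \<and> i = t)"
  by (rule sum_gate_coords[OF l]; blast)+

lemma sum_loc:
  "(\<Sum>e\<in>Ext (cell I i). of_bool ((h, i) \<in> path_arcs (vs l) \<and> i = t) * coords (cell I t) x e) =
    of_bool ((h, i) \<in> path_arcs (vs l) \<and> i = t)"
  by (rule sum_loc_coords) blast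

end

lemma route_vars_linking: "F2_linking I (route_vars I t x vs y)"
  unfolding F2_linking_def route_vars_def Let_def F2_vars.simps
  by (intro ballI)
    \<comment> \<open>The general \<open>c\<close> treats the constraints at a single extreme point.
      The instances \<open>c = 1\<close> treat \<open>rho_var\<close> and the totals over extreme
      points, where no factor is visible.\<close>
    (simp only: sum_gates sum_loc sum_arcs_out sum_arcs_in sum_arcs_end
      sum_arcs_out[where c = 1, unfolded mult_1_right] sum_arcs_in[where c = 1, unfolded mult_1_right]
      sum_arcs_end[where c = 1, unfolded mult_1_right] simp_thms ball_triv implies_True_equals)

lemma route_vars_feasible: "F2_feasible I (route_vars I t x vs y)"
  unfolding F2_feasible_def
  using route_vars_domains route_vars_location_and_flow route_vars_distances route_vars_linking by blast

lemma route_vars_objective: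
  "F2_objective I (route_vars I t x vs y) =
    (\<Sum>l\<in>demands I. demand_weight I l * travel_cost I l t x (vs l) (y l))"
  by (simp add: F2_objective_def route_vars_def Let_def travel_cost_def sum_distrib_left mult.assoc)

text \<open>Stated for arbitrary routes rather than optimal ones, so that it can be applied to
  near-optimal routes.\<close>

lemma F2_value_le_travel_costs:
  "F2_value I \<le> ereal (\<Sum>l\<in>demands I. demand_weight I l * travel_cost I l t x (vs l) (y l))"
  unfolding F2_value_def
  using route_vars_feasible route_vars_objective
  by (intro INF_lower2[of "route_vars I t x vs y"]) auto

lemma route_vars_encodes: "F2_encodes I (route_vars I t x vs y) t x vs y"
proof -
  have "x = (\<Sum>e\<in>Ext (cell I t). coords (cell I t) x e *\<^sub>R e)"
    using loc_coords(3) by simp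
  moreover have "y l i j = (\<Sum>e\<in>Ext (common_face I i j). coords (common_face I i j) (y l i j) e *\<^sub>R e)"
    if "l \<in> demands I" "(i, j) \<in> path_arcs (vs l)" for l i j
    using coords_combination[OF route_gate[OF that]] by simp
  ultimately show ?thesis
    unfolding F2_encodes_def F2_location_def route_vars_def Let_def F2_vars.simps by auto
qed

end

subsection \<open>From feasible points to routes\<close>

lemma sum_single_nonzero:
  fixes f :: "'a \<Rightarrow> real"
  assumes "finite A" "a \<in> A" "\<And>b. b \<in> A \<Longrightarrow> b \<noteq> a \<Longrightarrow> f b = 0"
  shows "sum f A = f a"
  using assms by (subst sum.remove[of A a]) (auto intro!: sum.neutral)

lemma sum_le_1_imp_others_0:
  fixes f :: "'a \<Rightarrow> real"
  assumes "finite A" "sum f A \<le> 1" "\<And>a. a \<in> A \<Longrightarrow> 0 \<le> f a" "a \<in> A" "f a = 1" "b \<in> A" "b \<noteq> a"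
  shows "f b = 0"
proof -
  have "sum f {a, b} \<le> sum f A"
    using assms by (intro sum_mono2) auto
  then have "f b \<le> 0" using assms(2,5,7) by simp
  then show ?thesis using assms(3,6) by (meson antisym)
qed

context
  fixes I :: "'d::finite loc_instance" and v t
  assumes subdivision: "polytopal_subdivision (cells I) (cell I)"
    and feasible: "F2_feasible I v"
    and t: "t \<in> cells I" "u_var v t = 1"
begin

lemmas feasible_parts = feasible[unfolded F2_feasible_def]
lemmas domains = feasible_parts[THEN conjunct1, unfolded F2_domains_def]
lemmas flow = feasible_parts[THEN conjunct2, THEN conjunct1, unfolded F2_location_and_flow_def]
lemmas distances = feasible_parts[THEN conjunct2, THEN conjunct2, THEN conjunct1, unfolded F2_distances_def]
lemmas linking = feasible_parts[THEN conjunct2, THEN conjunct2, THEN conjunct2, unfolded F2_linking_def]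

lemma u_var_eq: "i \<in> cells I \<Longrightarrow> u_var v i = of_bool (i = t)"
proof -
  assume i: "i \<in> cells I"
  have sum1: "(\<Sum>i\<in>cells I. u_var v i) \<le> 1" by (rule eq_refl[OF flow[THEN conjunct1]])
  have "0 \<le> u_var v i" if "i \<in> cells I" for i
  proof -
    have "u_var v i \<in> {0, 1}" by (rule domains[THEN conjunct1, THEN bspec, OF that])
    then show ?thesis by auto
  qed
  from sum_le_1_imp_others_0[OF finite_cells sum1 this t i] show ?thesis
    using t by auto
qed

lemma cell_polytope: "i \<in> cells I \<Longrightarrow> polytope (cell I i)"
  using subdivision by (simp add: polytopal_subdivision_def)

lemma location_in_cell: "F2_location I v t \<in> cell I t"
  unfolding F2_location_def
proof (rule convex_combination_in_polytope)
  show "polytope (cell I t)" by (rule cell_polytope[OF t(1)])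
  show "0 \<le> mu_var v t e" if "e \<in> Ext (cell I t)" for e
    using domains[THEN conjunct2, THEN conjunct1] t that by blast
  show "sum (mu_var v t) (Ext (cell I t)) = 1"
    using flow[THEN conjunct2, THEN conjunct1] t by auto
qed

context
  fixes l
  assumes l: "l \<in> demands I"
    and s_cell: "demand_cell I l \<in> cells I"
begin

lemmas flow_l = flow[THEN conjunct2, THEN conjunct2, THEN bspec, OF l, unfolded Let_def]

section \<open>Degrees of the flow and a path contained in it\<close>

lemma z_var_binary: "(i, j) \<in> arcs I \<Longrightarrow> z_var v l i j = 0 \<or> z_var v l i j = 1"
  using domains[THEN conjunct2, THEN conjunct2, THEN conjunct2, THEN conjunct1, THEN bspec, OF l] by auto

lemma z_var_nonneg: "(i, j) \<in> arcs I \<Longrightarrow> 0 \<le> z_var v l i j"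
  using z_var_binary by fastforce

lemma outflow:
  "i \<in> cells I \<Longrightarrow> (\<Sum>j | (i, j) \<in> arcs I. z_var v l i j) =
    (\<Sum>h | (h, i) \<in> arcs I. z_var v l h i) + of_bool (i = demand_cell I l) - of_bool (i = t)"
proof -
  assume i: "i \<in> cells I"
  have "(\<Sum>j | (i, j) \<in> arcs I. z_var v l i j) - (\<Sum>h | (h, i) \<in> arcs I. z_var v l h i) =
    of_bool (i = demand_cell I l) - u_var v i"
    using flow_l[THEN conjunct1] flow_l[THEN conjunct2, THEN conjunct1] i
    by (cases "i = demand_cell I l") auto
  then show ?thesis using u_var_eq[OF i] by simp
qed

lemma inflow_le: "i \<in> cells I \<Longrightarrow> (\<Sum>h | (h, i) \<in> arcs I. z_var v l h i) \<le> of_bool (demand_cell I l \<noteq> t)"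
  and outflow_le: "i \<in> cells I \<Longrightarrow> (\<Sum>j | (i, j) \<in> arcs I. z_var v l i j) \<le> of_bool (demand_cell I l \<noteq> t)"
proof -
  assume i: "i \<in> cells I"
  have "(\<Sum>h | (h, i) \<in> arcs I. z_var v l h i) \<le> 1 - u_var v (demand_cell I l)"
    "(\<Sum>j | (i, j) \<in> arcs I. z_var v l i j) \<le> 1 - u_var v (demand_cell I l)"
    using flow_l[THEN conjunct2, THEN conjunct2] i by blast+
  then show "(\<Sum>h | (h, i) \<in> arcs I. z_var v l h i) \<le> of_bool (demand_cell I l \<noteq> t)"
    "(\<Sum>j | (i, j) \<in> arcs I. z_var v l i j) \<le> of_bool (demand_cell I l \<noteq> t)"
    using u_var_eq[OF s_cell] by auto
qed

lemma z_var_other_pred: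
  assumes "(h, i) \<in> arcs I" "z_var v l h i = 1" "(h', i) \<in> arcs I" "h' \<noteq> h"
  shows "z_var v l h' i = 0"
proof (rule sum_le_1_imp_others_0[OF finite_predecessors[of i I], where f = "\<lambda>h. z_var v l h i"])
  show "(\<Sum>h | (h, i) \<in> arcs I. z_var v l h i) \<le> 1"
    using inflow_le[of i] arcs_in_cells[OF assms(1)] by (auto simp: of_bool_def split: if_splits)
qed (use assms z_var_nonneg in auto)

lemma z_var_other_succ:
  assumes "(i, j) \<in> arcs I" "z_var v l i j = 1" "(i, j') \<in> arcs I" "j' \<noteq> j"
  shows "z_var v l i j' = 0"
proof (rule sum_le_1_imp_others_0[OF finite_successors[of i I]])
  show "(\<Sum>j | (i, j) \<in> arcs I. z_var v l i j) \<le> 1"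
    using outflow_le[of i] arcs_in_cells[OF assms(1)] by (auto simp: of_bool_def split: if_splits)
qed (use assms z_var_nonneg in auto)

text \<open>If start and end differ, conservation makes the outflow of the start exceed its inflow
  by 1, while the outflow is at most 1; the end is symmetric. If they coincide, the degree bounds
  are already 0.\<close>

lemma no_arc_into_start: "(h, demand_cell I l) \<in> arcs I \<Longrightarrow> z_var v l h (demand_cell I l) = 0"
  and no_arc_out_of_end: "(t, j) \<in> arcs I \<Longrightarrow> z_var v l t j = 0"
proof -
  let ?s = "demand_cell I l"
  have "(\<Sum>h | (h, ?s) \<in> arcs I. z_var v l h ?s) \<le> 0"
    using outflow[OF s_cell] outflow_le[OF s_cell] inflow_le[OF s_cell]
    by (cases "?s = t") auto
  then have *: "(\<Sum>h | (h, ?s) \<in> arcs I. z_var v l h ?s) = 0"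
    by (intro antisym sum_nonneg) (auto intro: z_var_nonneg)
  show "(h, ?s) \<in> arcs I \<Longrightarrow> z_var v l h ?s = 0"
    by (rule sum_nonneg_0[OF finite_predecessors _ *]) (auto intro: z_var_nonneg)
  have "(\<Sum>j | (t, j) \<in> arcs I. z_var v l t j) \<le> 0"
    using outflow[OF t(1)] outflow_le[OF t(1)] inflow_le[OF t(1)]
    by (cases "?s = t") auto
  then have *: "(\<Sum>j | (t, j) \<in> arcs I. z_var v l t j) = 0"
    by (intro antisym sum_nonneg) (auto intro: z_var_nonneg)
  show "(t, j) \<in> arcs I \<Longrightarrow> z_var v l t j = 0"
    by (rule sum_nonneg_0[OF finite_successors _ *]) (auto intro: z_var_nonneg)
qed

text \<open>A longest simple path along arcs with \<open>z = 1\<close> must end in \<open>t\<close>: elsewhere flow conservation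
  provides a next arc, and the degree bounds prevent that arc from returning to the path. Cycles of
  the flow off the path are harmless, since they only add nonnegative distances.\<close>

lemma obtain_flow_path:
  obtains vs where "simple_path I (demand_cell I l) t vs"
    and "\<And>i j. (i, j) \<in> path_arcs vs \<Longrightarrow> z_var v l i j = 1"
proof -
  let ?s = "demand_cell I l"
  let ?walk = "\<lambda>vs. simple_path I ?s (last vs) vs \<and> (\<forall>(i, j)\<in>path_arcs vs. z_var v l i j = 1)"
  have "?walk [?s]" using s_cell by (simp add: simple_path_def path_arcs_def)
  moreover have "length vs < Suc (card (cells I))" if "?walk vs" for vs
    using that card_mono[OF finite_cells[of I], of "set vs"] distinct_card[of vs]
    by (auto simp: simple_path_def less_Suc_eq_le)
  ultimately obtain vs where vs: "?walk vs" and max: "\<And>ws. ?walk ws \<Longrightarrow> length ws \<le> length vs"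
    using ex_has_greatest_nat[of ?walk "[?s]" length "Suc (card (cells I))"] by blast
  have path: "simple_path I ?s (last vs) vs" and z1: "\<And>i j. (i, j) \<in> path_arcs vs \<Longrightarrow> z_var v l i j = 1"
    using vs by auto
  have ne: "vs \<noteq> []" and d: "distinct vs" and last_cell: "last vs \<in> cells I" and hd: "hd vs = ?s"
    using path by (auto simp: simple_path_def)
  have arcs: "path_arcs vs \<subseteq> arcs I" by (rule path_arcs_subset_arcs[OF path])
  \<comment> \<open>The final arc of a nontrivial walk supplies a unit of inflow to its last vertex.
    For the one-vertex walk, the unit comes from the source term in \<open>outflow\<close>
    instead.\<close>
  have in_le: "of_bool (last vs \<noteq> ?s) \<le> (\<Sum>h | (h, last vs) \<in> arcs I. z_var v l h (last vs))"
  proof -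
    have "(\<Sum>h | (h, last vs) \<in> arcs I. of_bool ((h, last vs) \<in> path_arcs vs)) \<le>
        (\<Sum>h | (h, last vs) \<in> arcs I. z_var v l h (last vs))"
      by (intro sum_mono) (auto simp: z1 z_var_nonneg of_bool_def)
    then show ?thesis using path_in_degree[OF path, of "last vs"] ne by simp
  qed
  have "last vs = t"
  proof (rule ccontr)
    assume nt: "last vs \<noteq> t"
    have "1 \<le> (\<Sum>j | (last vs, j) \<in> arcs I. z_var v l (last vs) j)"
      using outflow[OF last_cell] in_le nt by (cases "last vs = ?s") (auto simp: sum_nonneg z_var_nonneg)
    then have "(\<Sum>j | (last vs, j) \<in> arcs I. z_var v l (last vs) j) \<noteq> 0" by simp
    then obtain j where j: "(last vs, j) \<in> arcs I" "z_var v l (last vs) j \<noteq> 0"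
      by (rule sum.not_neutral_contains_not_neutral) blast
    then have zj: "z_var v l (last vs) j = 1" using z_var_binary by blast
    have "j \<notin> set vs"
    proof
      assume "j \<in> set vs"
      then obtain r where r: "r < length vs" "j = vs ! r" by (metis in_set_conv_nth)
      show False
      proof (cases r)
        case 0
        then have "j = ?s" using r hd ne by (simp add: hd_conv_nth)
        then show False using no_arc_into_start j by blast
      next
        case (Suc q)
        then have q: "(vs ! q, j) \<in> path_arcs vs" using r by (auto simp: path_arcs_conv_nth)
        \<comment> \<open>Otherwise position \<open>q\<close> would be the last one, although
          \<open>Suc q\<close> is also a position. Hence two different arcs with
          \<open>z_var\<close> equal to 1 would enter \<open>j\<close>.\<close>
        moreover have "last vs \<noteq> vs ! q"
          using r Suc d ne by (auto simp: last_conv_nth nth_eq_iff_index_eq)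
        ultimately show False
          using z_var_other_pred[of "vs ! q" j "last vs"] z1[OF q] arcs j by auto
      qed
    qed
    have "path_arcs (vs @ [j]) = insert (last vs, j) (path_arcs vs)"
    proof -
      have "zip (vs @ [j]) (tl (vs @ [j])) = zip vs (tl vs) @ [(last vs, j)]"
        using ne
      proof (induction vs)
        case (Cons a ws) then show ?case by (cases ws) auto
      qed simp
      then show ?thesis by (simp add: path_arcs_def)
    qed
    moreover have "simple_path I ?s j (vs @ [j])"
      using path \<open>j \<notin> set vs\<close> j(1) arcs_in_cells[OF j(1)]
      by (auto simp: simple_path_def successively_append_iff arcs_def)
    ultimately have "?walk (vs @ [j])" using z1 zj by auto
    from max[OF this] show False by simp
  qed
  then show thesis using that[of vs] path z1 by blast
qed

text \<open>A genuine gate point only on arcs carrying flow; where \<open>z_var\<close> is 0 the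
  weights sum to 0 and the combination is the origin.\<close>

definition gate :: "nat \<Rightarrow> nat \<Rightarrow> real ^ 'd" where
  "gate i j = (\<Sum>e\<in>Ext (common_face I i j). lambda_var v l i j e *\<^sub>R e)"

lemma gate_in_common_face:
  assumes "(i, j) \<in> arcs I" "z_var v l i j = 1"
  shows "gate i j \<in> common_face I i j"
  unfolding gate_def
proof (rule convex_combination_in_polytope)
  show "polytope (common_face I i j)" by (rule polytope_common_face[OF subdivision assms(1)])
  show "0 \<le> lambda_var v l i j e" if "e \<in> Ext (common_face I i j)" for e
    using domains[THEN conjunct2, THEN conjunct2, THEN conjunct2, THEN conjunct2, THEN conjunct1, THEN bspec, OF l]
      assms(1) that by blast
  show "sum (lambda_var v l i j) (Ext (common_face I i j)) = 1"
    using flow_l assms by auto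
qed

context
  fixes i
  assumes i: "i \<in> cells I" "i \<noteq> demand_cell I l"
begin

lemma i_cell: "i \<in> cells I - {demand_cell I l}"
  using i by blast

lemmas linking_i = linking[THEN bspec, OF l, THEN bspec, OF i_cell]
lemmas domains_i = domains[THEN conjunct2, THEN conjunct2, THEN conjunct2, THEN conjunct2, THEN conjunct2,
    THEN bspec, OF l, THEN bspec, OF i_cell]

lemma rho_nonneg: "(h, i) \<in> arcs I \<Longrightarrow> (i, j) \<in> arcs I \<Longrightarrow> 0 \<le> rho_var v l h i j"
  and Phi_nonneg: "(h, i) \<in> arcs I \<Longrightarrow> (i, j) \<in> arcs I \<Longrightarrow> e \<in> Ext (common_face I h i) \<Longrightarrow> 0 \<le> Phi_var v l h i j e"
  and Psi_nonneg: "(h, i) \<in> arcs I \<Longrightarrow> (i, j) \<in> arcs I \<Longrightarrow> e \<in> Ext (common_face I i j) \<Longrightarrow> 0 \<le> Psi_var v l h i j e"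
  and Upsilon_nonneg: "(h, i) \<in> arcs I \<Longrightarrow> e \<in> Ext (common_face I h i) \<Longrightarrow> 0 \<le> Upsilon_var v l h i e"
  and Theta_nonneg: "(h, i) \<in> arcs I \<Longrightarrow> e \<in> Ext (cell I i) \<Longrightarrow> 0 \<le> Theta_var v l h i e"
  using domains_i by blast+

lemma sum_rho_Theta: "(h, i) \<in> arcs I \<Longrightarrow>
    (\<Sum>j | (i, j) \<in> arcs I. rho_var v l h i j) + (\<Sum>e\<in>Ext (cell I i). Theta_var v l h i e) = z_var v l h i"
  and sum_rho: "(i, j) \<in> arcs I \<Longrightarrow> (\<Sum>h | (h, i) \<in> arcs I. rho_var v l h i j) = z_var v l i j"
  and sum_Phi: "(h, i) \<in> arcs I \<Longrightarrow> (i, j) \<in> arcs I \<Longrightarrow>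
    (\<Sum>e\<in>Ext (common_face I h i). Phi_var v l h i j e) = rho_var v l h i j"
  and sum_Phi_Upsilon: "(h, i) \<in> arcs I \<Longrightarrow> e \<in> Ext (common_face I h i) \<Longrightarrow>
    (\<Sum>j | (i, j) \<in> arcs I. Phi_var v l h i j e) + Upsilon_var v l h i e = lambda_var v l h i e"
  and sum_Psi: "(h, i) \<in> arcs I \<Longrightarrow> (i, j) \<in> arcs I \<Longrightarrow>
    (\<Sum>e\<in>Ext (common_face I i j). Psi_var v l h i j e) = rho_var v l h i j"
  and sum_Psi_pred: "(i, j) \<in> arcs I \<Longrightarrow> e \<in> Ext (common_face I i j) \<Longrightarrow>
    (\<Sum>h | (h, i) \<in> arcs I. Psi_var v l h i j e) = lambda_var v l i j e"
  and sum_Upsilon: "(\<Sum>h | (h, i) \<in> arcs I. \<Sum>e\<in>Ext (common_face I h i). Upsilon_var v l h i e) = u_var v i"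
  and sum_Theta: "e \<in> Ext (cell I i) \<Longrightarrow> (\<Sum>h | (h, i) \<in> arcs I. Theta_var v l h i e) = mu_var v i e"
  using linking_i by blast+

lemma finite_Ext_face: "(h, j) \<in> arcs I \<Longrightarrow> finite (Ext (common_face I h j))"
  by (rule finite_Ext[OF polytope_common_face[OF subdivision]])

text \<open>Since at most one arc with \<open>z = 1\<close> enters and at most one leaves a cell, the linking constraints
  force the split variables to agree with \<open>\<lambda>\<close> and \<open>\<mu>\<close> along the flow and to vanish elsewhere.\<close>

lemma rho_zero_pred:
  assumes "(h, i) \<in> arcs I" "(i, j) \<in> arcs I" "z_var v l h i = 0"
  shows "rho_var v l h i j = 0"
proof (rule sum_nonneg_0[OF finite_successors[of i I], where f = "rho_var v l h i"])
  have "0 \<le> (\<Sum>j | (i, j) \<in> arcs I. rho_var v l h i j)" "0 \<le> (\<Sum>e\<in>Ext (cell I i). Theta_var v l h i e)"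
    using assms by (auto intro!: sum_nonneg rho_nonneg Theta_nonneg)
  then show "(\<Sum>j | (i, j) \<in> arcs I. rho_var v l h i j) = 0"
    using sum_rho_Theta[OF assms(1)] assms(3) by linarith
qed (use assms rho_nonneg in auto)

lemma Theta_zero:
  assumes "(h, i) \<in> arcs I" "e \<in> Ext (cell I i)" "z_var v l h i = 0"
  shows "Theta_var v l h i e = 0"
proof (rule sum_nonneg_0[OF finite_Ext[OF cell_polytope[OF i(1)]], where f = "Theta_var v l h i"])
  have "0 \<le> (\<Sum>j | (i, j) \<in> arcs I. rho_var v l h i j)" "0 \<le> (\<Sum>e\<in>Ext (cell I i). Theta_var v l h i e)"
    using assms by (auto intro!: sum_nonneg rho_nonneg Theta_nonneg)
  then show "(\<Sum>e\<in>Ext (cell I i). Theta_var v l h i e) = 0"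
    using sum_rho_Theta[OF assms(1)] assms(3) by linarith
qed (use assms Theta_nonneg in auto)

lemma rho_zero_succ:
  assumes "(h, i) \<in> arcs I" "(i, j) \<in> arcs I" "z_var v l i j = 0"
  shows "rho_var v l h i j = 0"
proof (rule sum_nonneg_0[OF finite_predecessors[of i I], where f = "\<lambda>h. rho_var v l h i j"])
  show "(\<Sum>h | (h, i) \<in> arcs I. rho_var v l h i j) = 0"
    using sum_rho assms by simp
qed (use assms rho_nonneg in auto)

lemma Phi_zero:
  assumes "(h, i) \<in> arcs I" "(i, j) \<in> arcs I" "e \<in> Ext (common_face I h i)" "rho_var v l h i j = 0"
  shows "Phi_var v l h i j e = 0"
proof (rule sum_nonneg_0[OF finite_Ext_face[OF assms(1)], where f = "Phi_var v l h i j"])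
  show "(\<Sum>e\<in>Ext (common_face I h i). Phi_var v l h i j e) = 0"
    using sum_Phi assms by simp
qed (use assms Phi_nonneg in auto)

lemma Psi_zero:
  assumes "(h, i) \<in> arcs I" "(i, j) \<in> arcs I" "e \<in> Ext (common_face I i j)" "rho_var v l h i j = 0"
  shows "Psi_var v l h i j e = 0"
proof (rule sum_nonneg_0[OF finite_Ext_face[OF assms(2)], where f = "Psi_var v l h i j"])
  show "(\<Sum>e\<in>Ext (common_face I i j). Psi_var v l h i j e) = 0"
    using sum_Psi assms by simp
qed (use assms Psi_nonneg in auto)

lemma Upsilon_zero:
  assumes "(h, i) \<in> arcs I" "e \<in> Ext (common_face I h i)" "i \<noteq> t"
  shows "Upsilon_var v l h i e = 0"
proof -
  have "(\<Sum>h | (h, i) \<in> arcs I. \<Sum>e\<in>Ext (common_face I h i). Upsilon_var v l h i e) = 0"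
    using sum_Upsilon u_var_eq[OF i(1)] assms(3) by simp
  then have "(\<Sum>e\<in>Ext (common_face I h i). Upsilon_var v l h i e) = 0"
    by (rule sum_nonneg_0[OF finite_predecessors, rotated]) (auto intro: sum_nonneg Upsilon_nonneg assms)
  then show ?thesis
    by (rule sum_nonneg_0[OF finite_Ext_face[OF assms(1)], rotated]) (auto intro: Upsilon_nonneg assms)
qed

text \<open>\<open>Phi_var\<close> is tied to \<open>lambda_var\<close> by a sum over successors,
  hence the hypothesis concerns the leaving arc: no other successor carries flow, and
  \<open>Upsilon_var\<close> vanishes because an arc with flow leaves \<open>i\<close>, so
  \<open>i\<close> is not \<open>t\<close>.\<close>

lemma Phi_on_flow:
  assumes "(h, i) \<in> arcs I" "(i, j) \<in> arcs I" "z_var v l i j = 1" "e \<in> Ext (common_face I h i)"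
  shows "Phi_var v l h i j e = lambda_var v l h i e"
proof -
  have "i \<noteq> t" using no_arc_out_of_end assms by force
  moreover have "(\<Sum>j | (i, j) \<in> arcs I. Phi_var v l h i j e) = Phi_var v l h i j e"
    using Phi_zero[OF assms(1) _ assms(4) rho_zero_succ[OF assms(1) _ z_var_other_succ[OF assms(2,3)]]] assms(2)
    by (intro sum_single_nonzero finite_successors) simp_all
  ultimately show ?thesis
    using sum_Phi_Upsilon[OF assms(1,4)] Upsilon_zero assms by simp
qed

text \<open>Here the link to \<open>lambda_var\<close> is a sum over predecessors, so the hypothesis
  concerns the entering arc.\<close>

lemma Psi_on_flow:
  assumes "(h, i) \<in> arcs I" "(i, j) \<in> arcs I" "z_var v l h i = 1" "e \<in> Ext (common_face I i j)"
  shows "Psi_var v l h i j e = lambda_var v l i j e"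
proof -
  have "(\<Sum>h | (h, i) \<in> arcs I. Psi_var v l h i j e) = Psi_var v l h i j e"
    using Psi_zero[OF _ assms(2,4) rho_zero_pred[OF _ assms(2) z_var_other_pred[OF assms(1,3)]]] assms(1)
    by (intro sum_single_nonzero[where f = "\<lambda>h. Psi_var v l h i j e"] finite_predecessors) simp_all
  then show ?thesis using sum_Psi_pred assms by simp
qed

text \<open>No flow leaves \<open>t\<close>, so all \<open>rho_var\<close> and hence all
  \<open>Phi_var\<close> at \<open>t\<close> vanish.\<close>

lemma Upsilon_at_end:
  assumes "(h, i) \<in> arcs I" "i = t" "e \<in> Ext (common_face I h i)"
  shows "Upsilon_var v l h i e = lambda_var v l h i e"
proof -
  have "(\<Sum>j | (i, j) \<in> arcs I. Phi_var v l h i j e) = 0"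
    using Phi_zero[OF assms(1) _ assms(3) rho_zero_succ[OF assms(1)]] no_arc_out_of_end assms(2)
    by (intro sum.neutral) simp
  then show ?thesis using sum_Phi_Upsilon[OF assms(1,3)] by simp
qed

lemma Theta_on_flow:
  assumes "(h, i) \<in> arcs I" "z_var v l h i = 1" "e \<in> Ext (cell I i)"
  shows "Theta_var v l h i e = mu_var v i e"
proof -
  have "(\<Sum>h | (h, i) \<in> arcs I. Theta_var v l h i e) = Theta_var v l h i e"
    using Theta_zero[OF _ assms(3) z_var_other_pred[OF assms(1,2)]] assms(1)
    by (intro sum_single_nonzero[where f = "\<lambda>h. Theta_var v l h i e"] finite_predecessors) simp_all
  then show ?thesis using sum_Theta assms by simp
qed

end

text \<open>The comparison is term by term: on the path the two norms agree, and off the path the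
  left side is 0 while the right side is a norm.\<close>

lemma leg_length_le:
  assumes path: "simple_path I (demand_cell I l) t vs"
    and z1: "\<And>i j. (i, j) \<in> path_arcs vs \<Longrightarrow> z_var v l i j = 1"
    and i: "i \<in> cells I"
  shows "leg_length I l t (F2_location I v t) vs gate i \<le> d_var v l i"
proof -
  note dist = distances[THEN bspec, OF l, unfolded Let_def]
  have arcs: "(i, j) \<in> path_arcs vs \<Longrightarrow> (i, j) \<in> arcs I" for i j
    using path_arcs_subset_arcs[OF path] by blast
  show ?thesis
  proof (cases "i = demand_cell I l")
    case True
    have "leg_length I l t (F2_location I v t) vs gate i \<le>
       (\<Sum>j | (i, j) \<in> arcs I. cell_norm I i ((\<Sum>e\<in>Ext (common_face I i j). lambda_var v l i j e *\<^sub>R e)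
                            - z_var v l i j *\<^sub>R demand I l))
          + cell_norm I i ((\<Sum>e\<in>Ext (cell I i). mu_var v i e *\<^sub>R e) - u_var v i *\<^sub>R demand I l)"
      unfolding leg_length_def if_P[OF True] gate_def F2_location_def
      using u_var_eq[OF i]
      by (intro add_mono sum_mono) (auto simp: z1 lp_norm_nonneg of_bool_def)
    then show ?thesis using dist[THEN conjunct1] True by simp
  next
    case False
    have "of_bool ((h, i) \<in> path_arcs vs \<and> (i, j) \<in> path_arcs vs) * cell_norm I i (gate i j - gate h i)
      \<le> cell_norm I i ((\<Sum>e\<in>Ext (common_face I i j). Psi_var v l h i j e *\<^sub>R e)
                               - (\<Sum>e\<in>Ext (common_face I h i). Phi_var v l h i j e *\<^sub>R e))" for h j
    proof (cases "(h, i) \<in> path_arcs vs \<and> (i, j) \<in> path_arcs vs")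
      case True
      then have "(\<Sum>e\<in>Ext (common_face I i j). Psi_var v l h i j e *\<^sub>R e) = gate i j"
        "(\<Sum>e\<in>Ext (common_face I h i). Phi_var v l h i j e *\<^sub>R e) = gate h i"
        unfolding gate_def using arcs z1 i False
        by (auto intro!: sum.cong simp: Psi_on_flow Phi_on_flow)
      then show ?thesis using True by simp
    qed (auto simp: lp_norm_nonneg)
    moreover have "of_bool ((h, i) \<in> path_arcs vs \<and> i = t) * cell_norm I i (F2_location I v t - gate h i)
      \<le> cell_norm I i ((\<Sum>e\<in>Ext (cell I i). Theta_var v l h i e *\<^sub>R e)
                               - (\<Sum>e\<in>Ext (common_face I h i). Upsilon_var v l h i e *\<^sub>R e))" for h
    proof (cases "(h, i) \<in> path_arcs vs \<and> i = t")
      case True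
      then have "(\<Sum>e\<in>Ext (cell I i). Theta_var v l h i e *\<^sub>R e) = F2_location I v t"
        "(\<Sum>e\<in>Ext (common_face I h i). Upsilon_var v l h i e *\<^sub>R e) = gate h i"
        unfolding gate_def F2_location_def using arcs z1 i False
        by (auto intro!: sum.cong simp: Theta_on_flow Upsilon_at_end)
      then show ?thesis by (simp add: lp_norm_nonneg)
    qed (auto simp: lp_norm_nonneg)
    ultimately have "leg_length I l t (F2_location I v t) vs gate i \<le>
        (\<Sum>h | (h, i) \<in> arcs I. \<Sum>j | (i, j) \<in> arcs I.
                cell_norm I i ((\<Sum>e\<in>Ext (common_face I i j). Psi_var v l h i j e *\<^sub>R e)
                               - (\<Sum>e\<in>Ext (common_face I h i). Phi_var v l h i j e *\<^sub>R e)))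
             + (\<Sum>h | (h, i) \<in> arcs I.
                cell_norm I i ((\<Sum>e\<in>Ext (cell I i). Theta_var v l h i e *\<^sub>R e)
                               - (\<Sum>e\<in>Ext (common_face I h i). Upsilon_var v l h i e *\<^sub>R e)))"
      unfolding leg_length_def if_not_P[OF False] by (intro add_mono sum_mono)
    also have "\<dots> \<le> d_var v l i"
      using dist[THEN conjunct2] i False by blast
    finally show ?thesis .
  qed
qed

lemma obtain_route:
  obtains vs y where "is_route I l t vs y"
    and "\<And>i. i \<in> cells I \<Longrightarrow> leg_length I l t (F2_location I v t) vs y i \<le> d_var v l i"
proof (rule obtain_flow_path)
  fix vs
  assume path: "simple_path I (demand_cell I l) t vs"
    and z1: "\<And>i j. (i, j) \<in> path_arcs vs \<Longrightarrow> z_var v l i j = 1"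
  show thesis
  proof (rule that)
    show "is_route I l t vs gate"
      unfolding is_route_def using path path_arcs_subset_arcs[OF path] z1 gate_in_common_face by auto
    show "leg_length I l t (F2_location I v t) vs gate i \<le> d_var v l i" if "i \<in> cells I" for i
      using path z1 that by (rule leg_length_le)
  qed
qed

end

end

subsection \<open>Equivalence\<close>

lemma LocP_objective_le_F2_objective:
  assumes subdivision: "polytopal_subdivision (cells I) (cell I)"
    and cell_weights: "\<forall>i\<in>cells I. 0 < cell_weight I i"
    and demand_weights: "\<forall>l\<in>demands I. 0 < demand_weight I l"
    and demand_cells: "\<forall>l\<in>demands I. demand_cell I l \<in> cells I"
    and v: "F2_feasible I v" "t \<in> cells I" "u_var v t = 1"
  shows "LocP_objective I t (F2_location I v t) \<le> ereal (F2_objective I v)"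
proof -
  have "ereal (demand_weight I l) * loc_dist I t l (F2_location I v t)
      \<le> ereal (\<Sum>i\<in>cells I. demand_weight I l * cell_weight I i * d_var v l i)"
    if l: "l \<in> demands I" for l
  proof -
    obtain vs y where route: "is_route I l t vs y"
      and leg: "\<And>i. i \<in> cells I \<Longrightarrow> leg_length I l t (F2_location I v t) vs y i \<le> d_var v l i"
      using obtain_route[OF subdivision v l demand_cells[THEN bspec, OF l]] by blast
    have "travel_cost I l t (F2_location I v t) vs y \<le> (\<Sum>i\<in>cells I. cell_weight I i * d_var v l i)"
      unfolding travel_cost_def
      using leg cell_weights by (intro sum_mono mult_left_mono) (auto simp: less_imp_le)
    then have "demand_weight I l * travel_cost I l t (F2_location I v t) vs y
        \<le> (\<Sum>i\<in>cells I. demand_weight I l * cell_weight I i * d_var v l i)"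
      using demand_weights l by (simp add: mult.assoc sum_distrib_left[symmetric])
    moreover have "ereal (demand_weight I l) * loc_dist I t l (F2_location I v t) \<le>
        ereal (demand_weight I l) * ereal (travel_cost I l t (F2_location I v t) vs y)"
      using loc_dist_le_travel_cost[OF demand_cells[THEN bspec, OF l] route] demand_weights l
      by (intro ereal_mult_left_mono) (auto simp: less_imp_le)
    ultimately show ?thesis by (simp add: order_trans)
  qed
  then show ?thesis
    unfolding LocP_objective_def F2_objective_def sum_ereal[symmetric] by (rule sum_mono)
qed

lemma F2_feasible_unique_cell:
  assumes "F2_feasible I v"
  shows "\<exists>!t. t \<in> cells I \<and> u_var v t = 1"
proof -
  have sum: "(\<Sum>i\<in>cells I. u_var v i) = 1" and dom: "\<forall>i\<in>cells I. u_var v i \<in> {0, 1}"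
    using assms unfolding F2_feasible_def F2_domains_def F2_location_and_flow_def by simp_all
  then obtain t where "t \<in> cells I" "u_var v t \<noteq> 0"
    by (metis sum.neutral zero_neq_one)
  then have t: "t \<in> cells I" "u_var v t = 1" using dom by auto
  have "i = t" if i: "i \<in> cells I" "u_var v i = 1" for i
    using sum_le_1_imp_others_0[OF finite_cells eq_refl[OF sum] _ t i(1)] dom i by force
  with t show ?thesis by blast
qed

lemma F2_value_le_LocP_objective:
  assumes subdivision: "polytopal_subdivision (cells I) (cell I)"
    and cell_weights: "\<forall>i\<in>cells I. 0 < cell_weight I i"
    and demand_weights: "\<forall>l\<in>demands I. 0 < demand_weight I l"
    and demand_cells: "\<forall>l\<in>demands I. demand_cell I l \<in> cells I"
    and tx: "t \<in> cells I" "x \<in> cell I t"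
  shows "F2_value I \<le> LocP_objective I t x"
proof (cases "\<exists>l\<in>demands I. loc_dist I t l x = \<infinity>")
  case True
  \<comment> \<open>Positivity of the demand weight matters, since 0 times infinity is 0 in the
    extended reals.\<close>
  then have "LocP_objective I t x = \<infinity>"
    unfolding LocP_objective_def sum_Pinfty using demand_weights by (force simp: demands_def)
  then show ?thesis by simp
next
  case False
  define D where "D l = real_of_ereal (loc_dist I t l x)" for l
  \<comment> \<open>Nonnegativity excludes the value minus infinity, the other obstacle to passing
    to a real number.\<close>
  have D: "loc_dist I t l x = ereal (D l)" if "l \<in> demands I" for l
    using loc_dist_nonneg[OF cell_weights demand_cells[THEN bspec, OF that], of t x] False that
    unfolding D_def by (cases "loc_dist I t l x") auto
  show ?thesis
  proof (rule ereal_le_epsilon2)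
    fix \<epsilon> :: real assume "0 < \<epsilon>"
    define W where "W = (\<Sum>l\<in>demands I. demand_weight I l)"
    have W: "0 \<le> W" unfolding W_def using demand_weights by (intro sum_nonneg) (simp add: less_imp_le)
    \<comment> \<open>The error allowed per demand point is chosen so that the weighted total
      \<open>W * \<delta>\<close> stays below \<open>\<epsilon>\<close>; adding 1 keeps the quotient
      defined when there are no demand points.\<close>
    define \<delta> where "\<delta> = \<epsilon> / (W + 1)"
    have \<delta>: "0 < \<delta>" using W \<open>0 < \<epsilon>\<close> by (simp add: \<delta>_def)
    have "\<exists>vs y. is_route I l t vs y \<and> travel_cost I l t x vs y \<le> D l + \<delta>" if l: "l \<in> demands I" for l
    proof -
      have "loc_dist I t l x < ereal (D l + \<delta>)" using D[OF l] \<delta> by simp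
      then show ?thesis
        unfolding loc_dist_eq_INF_travel_cost[OF demand_cells[THEN bspec, OF l]] INF_less_iff by (auto intro: less_imp_le)
    qed
    then obtain vs y where routes: "\<forall>l\<in>demands I. is_route I l t (vs l) (y l)"
      and cost: "\<And>l. l \<in> demands I \<Longrightarrow> travel_cost I l t x (vs l) (y l) \<le> D l + \<delta>"
      by metis
    have "(\<Sum>l\<in>demands I. demand_weight I l * travel_cost I l t x (vs l) (y l))
        \<le> (\<Sum>l\<in>demands I. demand_weight I l * (D l + \<delta>))"
      using demand_weights cost by (intro sum_mono mult_left_mono) (auto simp: less_imp_le)
    also have "\<dots> = (\<Sum>l\<in>demands I. demand_weight I l * D l) + W * \<delta>"
      by (simp add: distrib_left sum.distrib W_def sum_distrib_right)
    also have "W * \<delta> \<le> \<epsilon>"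
      using W \<open>0 < \<epsilon>\<close> by (simp add: \<delta>_def field_simps)
    finally have "ereal (\<Sum>l\<in>demands I. demand_weight I l * travel_cost I l t x (vs l) (y l))
        \<le> ereal (\<Sum>l\<in>demands I. demand_weight I l * D l) + ereal \<epsilon>"
      by simp
    also have "ereal (\<Sum>l\<in>demands I. demand_weight I l * D l) = LocP_objective I t x"
      unfolding LocP_objective_def sum_ereal[symmetric] by (rule sum.cong) (auto simp: D)
    finally show "F2_value I \<le> LocP_objective I t x + ereal \<epsilon>"
      using F2_value_le_travel_costs[OF subdivision tx routes] by (rule order_trans[rotated])
  qed
qed

theorem theorem17:
  fixes I :: "'d::finite loc_instance"
  assumes subdivision: "polytopal_subdivision (cells I) (cell I)"
    and exponents: "\<forall>i\<in>cells I. 1 \<le> cell_exponent I i"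
    and cell_weights: "\<forall>i\<in>cells I. 0 < cell_weight I i"
    and demand_weights: "\<forall>l\<in>demands I. 0 < demand_weight I l"
    and assignment: "\<forall>l\<in>demands I. demand_cell I l \<in> cells I \<and> demand I l \<in> cell I (demand_cell I l)"
  shows "F2_value I = LocP_value I \<and>
    (\<forall>t x vs y. LocP_optimal_solution I t x vs y \<longrightarrow>
       (\<exists>v. F2_optimal I v \<and> F2_encodes I v t x vs y)) \<and>
    (\<forall>v. F2_optimal I v \<longrightarrow>
       (\<exists>!t. t \<in> cells I \<and> u_var v t = 1) \<and>
       (\<forall>t\<in>cells I. u_var v t = 1 \<longrightarrow> LocP_optimal I t (F2_location I v t)))"
proof -
  have demand_cells: "\<forall>l\<in>demands I. demand_cell I l \<in> cells I"
    using assignment by blast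
  note location = location_in_cell[OF subdivision]
    and unique_cell = F2_feasible_unique_cell
    and LocP_objective_le = LocP_objective_le_F2_objective[OF subdivision cell_weights demand_weights demand_cells]
  have LocP_value_le_objective: "LocP_value I \<le> LocP_objective I t x" if "t \<in> cells I" "x \<in> cell I t" for t x
    unfolding LocP_value_def using that by (intro INF_lower2[of "(t, x)"]) auto
  have "F2_value I \<le> LocP_value I"
    unfolding LocP_value_def
    using F2_value_le_LocP_objective[OF subdivision cell_weights demand_weights demand_cells]
    by (intro INF_greatest) auto
  moreover have "LocP_value I \<le> F2_value I"
    unfolding F2_value_def
  proof (intro INF_greatest)
    fix v assume "v \<in> {v. F2_feasible I v}"
    then have v: "F2_feasible I v" by simp
    then obtain t where t: "t \<in> cells I" "u_var v t = 1" using unique_cell by blast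
    show "LocP_value I \<le> ereal (F2_objective I v)"
      using LocP_value_le_objective[OF t(1) location[OF v t]] LocP_objective_le[OF v t] by (rule order_trans)
  qed
  ultimately have value_eq: "F2_value I = LocP_value I" by (rule antisym)
  moreover have "\<exists>v. F2_optimal I v \<and> F2_encodes I v t x vs y"
    if opt: "LocP_optimal_solution I t x vs y" for t x vs y
  proof -
    have tx: "t \<in> cells I" "x \<in> cell I t" and obj: "LocP_objective I t x = LocP_value I"
      and routes: "\<forall>l\<in>demands I. is_route I l t (vs l) (y l)"
      and dist: "\<And>l. l \<in> demands I \<Longrightarrow> demand_cell I l \<noteq> t \<Longrightarrow>
        ereal (route_cost I l t x (vs l) (y l)) = loc_dist I t l x"
      using opt by (auto simp: LocP_optimal_solution_def LocP_optimal_def)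
    have "loc_dist I t l x = ereal (travel_cost I l t x (vs l) (y l))" if l: "l \<in> demands I" for l
      using routes l dist[OF l] sum_leg_lengths[of I l t "vs l" x "y l"]
      by (auto simp: is_route_def travel_cost_def loc_dist_def Let_def)
    then have "ereal (F2_objective I (route_vars I t x vs y)) = LocP_objective I t x"
      unfolding route_vars_objective[OF subdivision tx routes] LocP_objective_def sum_ereal[symmetric]
      by (intro sum.cong) auto
    then have "F2_optimal I (route_vars I t x vs y)"
      using route_vars_feasible[OF subdivision tx routes] obj value_eq by (simp add: F2_optimal_def)
    then show ?thesis using route_vars_encodes[OF subdivision tx routes] by blast
  qed
  moreover have "LocP_optimal I t (F2_location I v t)"
    if v: "F2_optimal I v" and t: "t \<in> cells I" "u_var v t = 1" for v t
  proof -
    have feas: "F2_feasible I v" and opt: "ereal (F2_objective I v) = LocP_value I"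
      using v value_eq by (auto simp: F2_optimal_def)
    note loc = location[OF feas t]
    \<comment> \<open>The objective at the decoded location is squeezed between the optimal value
      and the cost of \<open>v\<close>, which is that same value.\<close>
    have eq: "LocP_objective I t (F2_location I v t) = LocP_value I"
      using LocP_objective_le[OF feas t] LocP_value_le_objective[OF t(1) loc] opt by (intro antisym) auto
    \<comment> \<open>The optimal value is finite because it equals the real objective value of
      \<open>v\<close>.\<close>
    have "LocP_value I < \<infinity>" unfolding opt[symmetric] by simp
    then show ?thesis using t loc eq by (simp add: LocP_optimal_def)
  qed
  ultimately show ?thesis
    using unique_cell unfolding F2_optimal_def by blast
qed

end
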